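(* Let $\mathfrak a=(f_1,\dots,f_r)\subseteq\mathbb C\{x,y\}$ be an $\mathfrak m$-primary ideal. Let $BP(\mathfrak a)=(B,\beta)$ be its weighted cluster of base points, weighted by virtual values, and let $K=\{p\in\mathcal N_O : h_p<v_p\}$, weighted by $v$, where $v_p=\min_i v_p(f_i)$, $h_O=0$ and $h_p=\sum_{p\to q}v_q$. Then $(B,\beta)$ and $(K,v)$ are equal. In particular, $K$ is finite.
   Context: Let $O$ be a smooth point of a complex surface $X$, $\mathcal O_{X,O}\cong\mathbb C\{x,y\}$ with maximal ideal $\mathfrak m$. $\mathcal N_O$ is the set consisting of $O$ and all points infinitely near to $O$, i.e. points on exceptional divisors of compositions of finitely many point blow-ups above $O$ (a point is identified with its images under blow-ups that are isomorphisms near it). The points on the exceptional divisor $E_p$ of the blow-up of $p$ form the first neighbourhood of $p$. For $p<q$ ($q$ infinitely near to $p$; $p$ precedes $q$), $q$ is proximate to $p$, written $q\to p$, if $q$ lies on $E_p$ as a proper or infinitely near point (i.e. on $E_p$ or on a strict transform of $E_p$). Every $q\neq O$ is proximate to exactly one point (free) or two points (satellite). For $0\ne f\in\mathbb C\{x,y\}$, $e_p(f)$ is the multiplicity at $p$ of the strict transform of $f=0$ and the value $v_p(f)$ is defined recursively by $v_p(f)=e_p(f)+\sum_{p\to q}v_q(f)$ (sum over the points $q$ to which $p$ is proximate); $v_p(0)=+\infty$. A cluster is a finite set of points of $\mathcal N_O$ containing with each point all points preceding it; a weighted cluster carries integer virtual multiplicities $e_p$ or, equivalently, virtual values $v_p$,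 related by $v_p=e_p+\sum_{p\to q}v_q$. Base points of an $\mathfrak m$-primary ideal $\mathfrak a$: let $e_O(\mathfrak a)=\min\{e_O(f):f\in\mathfrak a\}$. For $p$ in the first neighbourhood of $O$ let $\varphi_p:\mathcal O_{X,O}\to\mathcal O_{X_p,p}$ be the pull-back of functions, $z$ a local equation of $E_O$ near $p$, let $\mathfrak a_p$ be the ideal generated by $z^{-e_O(\mathfrak a)}\varphi_p(\mathfrak a)$, and $e_p(\mathfrak a)$ the minimum multiplicity at $p$ of elements of $\mathfrak a_p$; repeat recursively to define $e_p(\mathfrak a)$ for all $p\in\mathcal N_O$. $BP(\mathfrak a)$ is the weighted cluster of the points with $e_p(\mathfrak a)>0$, with virtual multiplicities $e_p(\mathfrak a)$; $\beta_p$ denote its virtual values. *)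

theory Defs
  imports "HOL-Analysis.Infinite_Sum" "HOL-Computational_Algebra.Formal_Power_Series"
    "HOL-Library.Extended_Nat"
begin

unbundle fps_syntax

section \<open>The ring of convergent power series in two variables\<close>

text \<open>
  A double series \<open>F :: complex fps fps\<close> stands for \<open>\<Sum>i j. F $ i $ j * x^i * y^j\<close>: the outer
  variable is \<open>x\<close>, the inner variable is \<open>y\<close>.
\<close>

definition convergent_fps2 :: "complex fps fps \<Rightarrow> bool" where
  "convergent_fps2 F \<longleftrightarrow>
     (\<exists>\<rho>>0. (\<lambda>(i, j). norm (F $ i $ j) * \<rho> ^ (i + j)) summable_on (UNIV :: (nat \<times> nat) set))"

lemma convergent_fps2_iff_bounded:
  "convergent_fps2 F \<longleftrightarrow> (\<exists>C R. C \<ge> 0 \<and> R \<ge> 1 \<and> (\<forall>i j. norm (F $ i $ j) \<le> C * R ^ (i + j)))"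
proof
  assume "convergent_fps2 F"
  then obtain \<rho> where \<rho>: "\<rho> > 0"
    and s: "(\<lambda>(i, j). norm (F $ i $ j) * \<rho> ^ (i + j)) summable_on (UNIV :: (nat \<times> nat) set)"
    unfolding convergent_fps2_def by blast
  define C where "C = infsum (\<lambda>(i, j). norm (F $ i $ j) * \<rho> ^ (i + j)) (UNIV :: (nat \<times> nat) set)"
  have le: "norm (F $ i $ j) * \<rho> ^ (i + j) \<le> C" for i j
  proof -
    have "sum (\<lambda>(i, j). norm (F $ i $ j) * \<rho> ^ (i + j)) {(i, j)} \<le> C"
      unfolding C_def by (rule finite_sum_le_infsum[OF s]) (use \<rho> in \<open>auto\<close>)
    then show ?thesis by simp
  qed
  have C: "C \<ge> 0"
    using le[of 0 0] by (rule order_trans[rotated]) simp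
  define R where "R = max 1 (1 / \<rho>)"
  have "norm (F $ i $ j) \<le> C * R ^ (i + j)" for i j
  proof -
    have "norm (F $ i $ j) \<le> C * (1 / \<rho>) ^ (i + j)"
      using le[of i j] \<rho> by (simp add: power_one_over field_simps)
    also have "\<dots> \<le> C * R ^ (i + j)"
      by (intro mult_left_mono power_mono) (use C \<rho> in \<open>auto simp: R_def\<close>)
    finally show ?thesis .
  qed
  then show "\<exists>C R. C \<ge> 0 \<and> R \<ge> 1 \<and> (\<forall>i j. norm (F $ i $ j) \<le> C * R ^ (i + j))"
    using C by (intro exI[of _ C] exI[of _ R]) (auto simp: R_def)
next
  assume "\<exists>C R. C \<ge> 0 \<and> R \<ge> 1 \<and> (\<forall>i j. norm (F $ i $ j) \<le> C * R ^ (i + j))"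
  then obtain C R where C: "C \<ge> 0" and R: "R \<ge> (1::real)"
    and b: "\<And>i j. norm (F $ i $ j) \<le> C * R ^ (i + j)" by blast
  define \<rho> where "\<rho> = 1 / (2 * R)"
  have \<rho>: "\<rho> > 0" using R by (simp add: \<rho>_def)
  have geo: "sum (\<lambda>i. (1/2 :: real) ^ i) {..<N} \<le> 2" for N
  proof -
    have "sum (\<lambda>i. (1/2 :: real) ^ i) {..<N} = 2 - 2 * (1/2) ^ N"
      by (induction N) auto
    then show ?thesis by simp
  qed
  have term_le: "norm (F $ i $ j) * \<rho> ^ (i + j) \<le> C * ((1/2) ^ i * (1/2) ^ j)" for i j
  proof -
    have "norm (F $ i $ j) * \<rho> ^ (i + j) \<le> (C * R ^ (i + j)) * \<rho> ^ (i + j)"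
      by (intro mult_right_mono b) (use \<rho> in auto)
    also have "\<dots> = C * ((R * \<rho>) ^ (i + j))" by (simp add: power_mult_distrib)
    also have "R * \<rho> = 1/2" using R by (simp add: \<rho>_def)
    finally show ?thesis by (simp add: power_add)
  qed
  have "(\<lambda>(i, j). norm (F $ i $ j) * \<rho> ^ (i + j)) summable_on (UNIV :: (nat \<times> nat) set)"
  proof (rule nonneg_bdd_above_summable_on)
    show "bdd_above (sum (\<lambda>(i, j). norm (F $ i $ j) * \<rho> ^ (i + j)) `
            {A. A \<subseteq> (UNIV :: (nat \<times> nat) set) \<and> finite A})"
    proof (rule bdd_aboveI2)
      fix A :: "(nat \<times> nat) set" assume "A \<in> {A. A \<subseteq> UNIV \<and> finite A}"
      then have fin: "finite A" by simp
      obtain N where N: "\<forall>k\<in>fst ` A \<union> snd ` A. k < N"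
        using finite_nat_set_iff_bounded[of "fst ` A \<union> snd ` A"] fin by auto
      have "A \<subseteq> {..<N} \<times> {..<N}" using N by force
      then have "sum (\<lambda>(i, j). norm (F $ i $ j) * \<rho> ^ (i + j)) A
              \<le> sum (\<lambda>(i, j). norm (F $ i $ j) * \<rho> ^ (i + j)) ({..<N} \<times> {..<N})"
        by (intro sum_mono2) (use \<rho> in auto)
      also have "\<dots> \<le> sum (\<lambda>(i, j). C * ((1/2) ^ i * (1/2) ^ j)) ({..<N} \<times> {..<N})"
        by (intro sum_mono) (use term_le in auto)
      also have "\<dots> = C * (sum (\<lambda>i. (1/2) ^ i) {..<N} * sum (\<lambda>i. (1/2) ^ i) {..<N})"
        by (subst sum_product)
           (simp add: sum.cartesian_product[symmetric] sum_distrib_left)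
      also have "\<dots> \<le> C * (2 * 2)"
        by (intro mult_left_mono mult_mono geo C) (auto intro: sum_nonneg)
      finally show "sum (\<lambda>(i, j). norm (F $ i $ j) * \<rho> ^ (i + j)) A \<le> C * (2 * 2)" .
    qed
  qed (use \<rho> in auto)
  then show "convergent_fps2 F" unfolding convergent_fps2_def using \<rho> by blast
qed

lemma convergent_fps2I:
  assumes "C \<ge> 0" "R \<ge> 1" "\<And>i j. norm (F $ i $ j) \<le> C * R ^ (i + j)"
  shows "convergent_fps2 F"
  unfolding convergent_fps2_iff_bounded using assms by blast

lemma convergent_fps2E:
  assumes "convergent_fps2 F"
  obtains C R where "C \<ge> 0" "R \<ge> 1" "\<And>i j. norm (F $ i $ j) \<le> C * R ^ (i + j)"
  using assms unfolding convergent_fps2_iff_bounded by blast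

lemma convergent_fps2_const [simp]: "convergent_fps2 (fps_const (fps_const c))"
proof (rule convergent_fps2I[of "norm c" 1])
  show "norm (fps_const (fps_const c) $ i $ j) \<le> norm c * 1 ^ (i + j)" for i j
    by (cases i; cases j) auto
qed auto

lemma convergent_fps2_X [simp]: "convergent_fps2 fps_X"
proof (rule convergent_fps2I[of 1 1])
  show "norm ((fps_X :: complex fps fps) $ i $ j) \<le> 1 * 1 ^ (i + j)" for i j
    by (cases j) (auto simp: fps_X_def)
qed auto

lemma convergent_fps2_Y [simp]: "convergent_fps2 (fps_const fps_X)"
proof (rule convergent_fps2I[of 1 1])
  show "norm (fps_const (fps_X :: complex fps) $ i $ j) \<le> 1 * 1 ^ (i + j)" for i j
    by (cases i) (auto simp: fps_X_def)
qed auto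

lemma convergent_fps2_uminus [simp]: "convergent_fps2 F \<Longrightarrow> convergent_fps2 (- F)"
  unfolding convergent_fps2_def by simp

lemma convergent_fps2_add [simp]:
  assumes "convergent_fps2 F" "convergent_fps2 G"
  shows "convergent_fps2 (F + G)"
proof -
  obtain C R where F: "C \<ge> 0" "R \<ge> 1" "\<And>i j. norm (F $ i $ j) \<le> C * R ^ (i + j)"
    using convergent_fps2E[OF assms(1)] by blast
  obtain D S where G: "D \<ge> 0" "S \<ge> 1" "\<And>i j. norm (G $ i $ j) \<le> D * S ^ (i + j)"
    using convergent_fps2E[OF assms(2)] by blast
  show ?thesis
  proof (rule convergent_fps2I[of "C + D" "max R S"])
    fix i j
    have "norm ((F + G) $ i $ j) \<le> C * R ^ (i + j) + D * S ^ (i + j)"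
      using norm_triangle_mono[OF F(3) G(3)] by simp
    also have "\<dots> \<le> C * max R S ^ (i + j) + D * max R S ^ (i + j)"
      by (intro add_mono mult_left_mono power_mono) (use F G in auto)
    finally show "norm ((F + G) $ i $ j) \<le> (C + D) * max R S ^ (i + j)"
      by (simp add: algebra_simps)
  qed (use F G in auto)
qed

lemma convergent_fps2_diff [simp]:
  "convergent_fps2 F \<Longrightarrow> convergent_fps2 G \<Longrightarrow> convergent_fps2 (F - G)"
  using convergent_fps2_add[of F "- G"] by simp

lemma Suc_le_two_power: "real (Suc n) \<le> 2 ^ n"
  by (induction n) auto

lemma convergent_fps2_mult [simp]:
  assumes "convergent_fps2 F" "convergent_fps2 G"
  shows "convergent_fps2 (F * G)"
proof -
  obtain C R where F: "C \<ge> 0" "R \<ge> 1" "\<And>i j. norm (F $ i $ j) \<le> C * R ^ (i + j)"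
    using convergent_fps2E[OF assms(1)] by blast
  obtain D S where G: "D \<ge> 0" "S \<ge> 1" "\<And>i j. norm (G $ i $ j) \<le> D * S ^ (i + j)"
    using convergent_fps2E[OF assms(2)] by blast
  define T where "T = max R S"
  have T: "T \<ge> 1" using F by (simp add: T_def)
  show ?thesis
  proof (rule convergent_fps2I[of "C * D" "2 * T"])
    fix i j
    have fT: "norm (F $ k $ l) \<le> C * T ^ (k + l)" for k l
      using F by (intro order_trans[OF F(3)] mult_left_mono power_mono) (auto simp: T_def)
    have gT: "norm (G $ k $ l) \<le> D * T ^ (k + l)" for k l
      using G by (intro order_trans[OF G(3)] mult_left_mono power_mono) (auto simp: T_def)
    have t: "norm (F $ k $ l * G $ (i - k) $ (j - l)) \<le> C * D * T ^ (i + j)"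
      if "k \<in> {0..i}" "l \<in> {0..j}" for k l
    proof -
      have "norm (F $ k $ l * G $ (i - k) $ (j - l))
          \<le> (C * T ^ (k + l)) * (D * T ^ ((i - k) + (j - l)))"
        unfolding norm_mult by (intro mult_mono fT gT) (use F T in auto)
      also have "\<dots> = C * D * T ^ ((k + l) + ((i - k) + (j - l)))"
        by (simp only: power_add) (simp add: algebra_simps)
      also have "(k + l) + ((i - k) + (j - l)) = i + j" using that by auto
      finally show ?thesis .
    qed
    have "norm ((F * G) $ i $ j)
        = norm (\<Sum>k=0..i. \<Sum>l=0..j. F $ k $ l * G $ (i - k) $ (j - l))"
      by (simp add: fps_mult_nth fps_sum_nth)
    also have "\<dots> \<le> (\<Sum>k=0..i. \<Sum>l=0..j. C * D * T ^ (i + j))"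
      by (rule order_trans[OF norm_sum] sum_mono t)+ auto
    also have "\<dots> = C * D * T ^ (i + j) * (real (Suc i) * real (Suc j))"
      by simp
    also have "\<dots> \<le> C * D * T ^ (i + j) * (2 ^ i * 2 ^ j)"
      by (intro mult_left_mono mult_mono Suc_le_two_power) (use F G T in auto)
    also have "\<dots> = C * D * (2 * T) ^ (i + j)"
      by (simp add: power_mult_distrib power_add)
    finally show "norm ((F * G) $ i $ j) \<le> C * D * (2 * T) ^ (i + j)" .
  qed (use F G T in auto)
qed

typedef cps = "{F. convergent_fps2 F}"
  by (rule exI[of _ "fps_const (fps_const 0)"]) (simp only: mem_Collect_eq convergent_fps2_const)

setup_lifting type_definition_cps

lift_definition cps_coeff :: "cps \<Rightarrow> nat \<Rightarrow> nat \<Rightarrow> complex" is "\<lambda>F i j. F $ i $ j" .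

lift_definition cps_const :: "complex \<Rightarrow> cps" is "\<lambda>c. fps_const (fps_const c)" by simp

lift_definition cps_X :: cps is fps_X by simp

lift_definition cps_Y :: cps is "fps_const fps_X" by simp

instantiation cps :: idom
begin

lift_definition zero_cps :: cps is 0
  using convergent_fps2_const[of 0] by simp

lift_definition one_cps :: cps is 1
  using convergent_fps2_const[of 1] by simp

lift_definition plus_cps :: "cps \<Rightarrow> cps \<Rightarrow> cps" is "(+)" by simp

lift_definition minus_cps :: "cps \<Rightarrow> cps \<Rightarrow> cps" is "(-)" by simp

lift_definition uminus_cps :: "cps \<Rightarrow> cps" is uminus by simp

lift_definition times_cps :: "cps \<Rightarrow> cps \<Rightarrow> cps" is "(*)" by simp

instance
  by standard (transfer; simp add: algebra_simps)+

end

text \<open>Ideals of \<open>cps\<close> are its submodules, and \<open>ideal.span S\<close> is the ideal generated by \<open>S\<close>.\<close>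

interpretation ideal: module "(*) :: cps \<Rightarrow> cps \<Rightarrow> cps"
  by standard (simp_all add: algebra_simps)

definition max_ideal :: "cps set" where
  "max_ideal = {f. cps_coeff f 0 0 = 0}"

definition primary_ideal :: "cps set \<Rightarrow> bool" where
  "primary_ideal \<aa> \<longleftrightarrow> ideal.subspace \<aa> \<and> \<aa> \<noteq> UNIV \<and>
     (\<forall>f g. f * g \<in> \<aa> \<longrightarrow> f \<in> \<aa> \<or> (\<exists>n. g ^ n \<in> \<aa>))"

definition ideal_radical :: "cps set \<Rightarrow> cps set" where
  "ideal_radical \<aa> = {f. \<exists>n. f ^ n \<in> \<aa>}"

definition m_primary :: "cps set \<Rightarrow> bool" where
  "m_primary \<aa> \<longleftrightarrow> primary_ideal \<aa> \<and> ideal_radical \<aa> = max_ideal"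


section \<open>Infinitely near points\<close>

text \<open>
  The exceptional divisor of the blow-up of a smooth point with local coordinates \<open>x, y\<close> is the
  projective line of tangent directions at that point. Around the direction \<open>y = t x\<close>
  (\<open>Slope t\<close>) the blown-up surface has local coordinates \<open>x', y'\<close> with \<open>x = x'\<close> and
  \<open>y = x' (y' + t)\<close>; around the direction \<open>x = 0\<close> (\<open>Vertical\<close>) it has local coordinates \<open>x', y'\<close>
  with \<open>x = x' y'\<close> and \<open>y = y'\<close>. All these coordinates vanish at the point in question, so the local
  ring there is again \<open>cps\<close>.

  With these coordinates fixed, a point equal or infinitely near to the origin \<open>O\<close> is the finite list of
  the directions leading to it from \<open>O\<close>: \<open>O\<close> is \<open>[]\<close>, the first neighbourhood of \<open>p\<close> consists of
  the points \<open>p @ [d]\<close>, and \<open>p\<close> precedes \<open>q\<close> iff \<open>p\<close> is a proper prefix of \<open>q\<close>.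
\<close>

datatype direction = Slope complex | Vertical

type_synonym point = "direction list"

lemma norm_nth_power_X_plus_const_le:
  "norm (((fps_X + fps_const t) ^ j :: complex fps) $ k) \<le> (1 + norm t) ^ j"
proof (induction j arbitrary: k)
  case 0
  then show ?case by (cases k) auto
next
  case (Suc j)
  let ?P = "(fps_X + fps_const t) ^ j :: complex fps"
  have "((fps_X + fps_const t) ^ Suc j) $ k = (if k = 0 then 0 else ?P $ (k - 1)) + t * ?P $ k"
    by (simp add: algebra_simps)
  also have "norm \<dots> \<le> (1 + norm t) ^ j + norm t * (1 + norm t) ^ j"
  proof (rule norm_triangle_mono)
    show "norm (if k = 0 then 0 else ?P $ (k - 1)) \<le> (1 + norm t) ^ j"
      using Suc.IH[of "k - 1"] by auto
    show "norm (t * ?P $ k) \<le> norm t * (1 + norm t) ^ j"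
      unfolding norm_mult by (intro mult_left_mono Suc.IH) auto
  qed
  finally show ?case by (simp add: algebra_simps)
qed

text \<open>
  Grouping \<open>f = \<Sum>i j. a\<^sub>i\<^sub>j x^i y^j\<close> by total degree \<open>n = i + j\<close> gives
  \<open>f (x, x (y + t)) = \<Sum>n. x^n (\<Sum>j\<le>n. a\<^sub>n\<^sub>-\<^sub>j\<^sub>,\<^sub>j (y + t)^j)\<close>.
\<close>

lift_definition pullback_slope :: "complex \<Rightarrow> cps \<Rightarrow> cps" is
  "\<lambda>t F. Abs_fps (\<lambda>n. \<Sum>j\<le>n. fps_const (F $ (n - j) $ j) * (fps_X + fps_const t) ^ j)"
proof -
  fix t :: complex and F :: "complex fps fps"
  assume conv: "convergent_fps2 F"
  obtain C R where F: "C \<ge> 0" "R \<ge> 1" "\<And>i j. norm (F $ i $ j) \<le> C * R ^ (i + j)"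
    using convergent_fps2E[OF conv] by blast
  define T where "T = 1 + norm t"
  have T: "T \<ge> 1" by (simp add: T_def)
  show "convergent_fps2
    (Abs_fps (\<lambda>n. \<Sum>j\<le>n. fps_const (F $ (n - j) $ j) * (fps_X + fps_const t) ^ j))"
  proof (rule convergent_fps2I[of C "2 * (R * T)"])
    fix n k
    have t: "norm (F $ (n - j) $ j * ((fps_X + fps_const t) ^ j) $ k) \<le> C * R ^ n * T ^ n"
      if "j \<in> {..n}" for j
    proof -
      have "norm (F $ (n - j) $ j * ((fps_X + fps_const t) ^ j) $ k)
          \<le> (C * R ^ ((n - j) + j)) * T ^ j"
        unfolding norm_mult
        by (intro mult_mono F(3) norm_nth_power_X_plus_const_le[of t j k, folded T_def]) (use F in auto)
      also have "\<dots> \<le> (C * R ^ n) * T ^ n"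
        by (intro mult_mono power_increasing) (use F T that in auto)
      finally show ?thesis .
    qed
    have "norm (Abs_fps (\<lambda>n. \<Sum>j\<le>n. fps_const (F $ (n - j) $ j) * (fps_X + fps_const t) ^ j) $ n $ k)
       = norm (\<Sum>j\<le>n. F $ (n - j) $ j * ((fps_X + fps_const t) ^ j) $ k)"
      by (simp add: fps_sum_nth)
    also have "\<dots> \<le> (\<Sum>j\<le>n. C * R ^ n * T ^ n)"
      by (rule order_trans[OF norm_sum] sum_mono t)+
    also have "\<dots> = C * (R * T) ^ n * real (Suc n)"
      by (simp add: power_mult_distrib)
    also have "\<dots> \<le> C * (R * T) ^ n * 2 ^ n"
      by (intro mult_left_mono Suc_le_two_power) (use F T in auto)
    also have "\<dots> = C * (2 * (R * T)) ^ n"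
      by (simp add: power_mult_distrib)
    also have "\<dots> \<le> C * (2 * (R * T)) ^ (n + k)"
    proof (intro mult_left_mono power_increasing)
      have "1 * 1 \<le> R * T" by (intro mult_mono) (use F T in auto)
      then show "1 \<le> 2 * (R * T)" by simp
    qed (use F in auto)
    finally show "norm (Abs_fps (\<lambda>n. \<Sum>j\<le>n. fps_const (F $ (n - j) $ j) * (fps_X + fps_const t) ^ j) $ n $ k)
        \<le> C * (2 * (R * T)) ^ (n + k)" .
  next
    have "1 * 1 \<le> R * T" by (intro mult_mono) (use F T in auto)
    then show "1 \<le> 2 * (R * T)" by simp
  qed (use F in auto)
qed

text \<open>\<open>f (x y, y) = \<Sum>i k. a\<^sub>i\<^sub>k x^i y^(i + k)\<close>.\<close>

lift_definition pullback_vertical :: "cps \<Rightarrow> cps" is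
  "\<lambda>F. Abs_fps (\<lambda>i. Abs_fps (\<lambda>n. if i \<le> n then F $ i $ (n - i) else 0))"
proof -
  fix F :: "complex fps fps"
  assume conv: "convergent_fps2 F"
  obtain C R where F: "C \<ge> 0" "R \<ge> 1" "\<And>i j. norm (F $ i $ j) \<le> C * R ^ (i + j)"
    using convergent_fps2E[OF conv] by blast
  show "convergent_fps2 (Abs_fps (\<lambda>i. Abs_fps (\<lambda>n. if i \<le> n then F $ i $ (n - i) else 0)))"
  proof (rule convergent_fps2I[of C R])
    fix i n
    have "C * R ^ n \<le> C * R ^ (i + n)"
      by (intro mult_left_mono power_increasing) (use F in auto)
    then show "norm (Abs_fps (\<lambda>i. Abs_fps (\<lambda>n. if i \<le> n then F $ i $ (n - i) else 0)) $ i $ n)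
        \<le> C * R ^ (i + n)"
      using F(3)[of i "n - i"] F(1,2) by auto
  qed (use F in auto)
qed

fun pullback :: "direction \<Rightarrow> cps \<Rightarrow> cps" where
  "pullback (Slope t) f = pullback_slope t f"
| "pullback Vertical f = pullback_vertical f"

text \<open>Local equation, at the point of direction \<open>d\<close>, of the exceptional divisor just created.\<close>

fun exc :: "direction \<Rightarrow> cps" where
  "exc (Slope t) = cps_X"
| "exc Vertical = cps_Y"

lemma pullback_X: "pullback d cps_X = (case d of Slope t \<Rightarrow> cps_X | Vertical \<Rightarrow> cps_X * cps_Y)"
proof (cases d)
  case (Slope t)
  have "pullback_slope t cps_X = cps_X"
  proof (transfer, intro fps_ext)
    fix t :: complex and n k
    have "(\<Sum>j\<le>n. fps_const ((fps_X :: complex fps fps) $ (n - j) $ j) * (fps_X + fps_const t) ^ j)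
        = (\<Sum>j\<le>n. if j = 0 then (if n = 1 then 1 else 0) else 0)"
      by (intro sum.cong) (auto simp: fps_X_def)
    then show "Abs_fps (\<lambda>n. \<Sum>j\<le>n. fps_const (fps_X $ (n - j) $ j) *
                  (fps_X + fps_const t) ^ j) $ n $ k = fps_X $ n $ k"
      by (simp add: fps_X_def)
  qed
  then show ?thesis using Slope by simp
next
  case Vertical
  have "pullback_vertical cps_X = cps_X * cps_Y"
  proof (transfer, intro fps_ext)
    fix i n
    show "Abs_fps (\<lambda>i. Abs_fps (\<lambda>n. if i \<le> n then fps_X $ i $ (n - i) else 0)) $ i $ n
        = (fps_X * fps_const (fps_X :: complex fps)) $ i $ n"
      by (auto simp: fps_mult_right_const_nth fps_X_def)
  qed
  then show ?thesis using Vertical by simp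
qed

lemma pullback_Y: "pullback d cps_Y = (case d of Slope t \<Rightarrow> cps_X * (cps_Y + cps_const t) | Vertical \<Rightarrow> cps_Y)"
proof (cases d)
  case (Slope t)
  have "pullback_slope t cps_Y = cps_X * (cps_Y + cps_const t)"
  proof (transfer, intro fps_ext)
    fix t :: complex and n k
    have "(\<Sum>j\<le>n. fps_const ((fps_const fps_X :: complex fps fps) $ (n - j) $ j) * (fps_X + fps_const t) ^ j)
        = (\<Sum>j\<le>n. if j = 1 then (if n = 1 then fps_X + fps_const t else 0) else 0)"
      by (intro sum.cong) auto
    then show "Abs_fps (\<lambda>n. \<Sum>j\<le>n. fps_const (fps_const fps_X $ (n - j) $ j) *
                  (fps_X + fps_const t) ^ j) $ n $ k
        = (fps_X * (fps_const fps_X + fps_const (fps_const t))) $ n $ k"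
      by (cases "n = 1") auto
  qed
  then show ?thesis using Slope by simp
next
  case Vertical
  have "pullback_vertical cps_Y = cps_Y"
    by (transfer, intro fps_ext) auto
  then show ?thesis using Vertical by simp
qed


section \<open>Multiplicities, proximity and values\<close>

text \<open>The multiplicity at the origin of a nonzero series (unspecified for \<open>0\<close>).\<close>

definition cps_multiplicity :: "cps \<Rightarrow> nat" where
  "cps_multiplicity f = (LEAST n. \<exists>i j. i + j = n \<and> cps_coeff f i j \<noteq> 0)"

text \<open>
  The strict transform at the point of direction \<open>d\<close>: the total transform with the exceptional divisor
  removed as many times as the multiplicity. It is meant for nonzero series.
\<close>

definition strict_transform1 :: "direction \<Rightarrow> cps \<Rightarrow> cps" where
  "strict_transform1 d f = (THE g. pullback d f = exc d ^ cps_multiplicity f * g)"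

definition strict_transform :: "point \<Rightarrow> cps \<Rightarrow> cps" where
  "strict_transform p f = fold strict_transform1 p f"

definition mult_at :: "point \<Rightarrow> cps \<Rightarrow> nat" where
  "mult_at p f = cps_multiplicity (strict_transform p f)"

text \<open>
  \<open>proximate q p\<close>: \<open>q\<close> is infinitely near to \<open>p\<close> and lies on \<open>E\<^sub>p\<close> or on a strict transform of it. At the
  point \<open>p @ [d]\<close>, \<open>E\<^sub>p\<close> has the equation \<open>exc d\<close>; its strict transform is followed from there to \<open>q\<close>.
\<close>

definition proximate :: "point \<Rightarrow> point \<Rightarrow> bool" where
  "proximate q p \<longleftrightarrow>
     (\<exists>d ds. q = p @ d # ds \<and> cps_coeff (strict_transform ds (exc d)) 0 0 = 0)"

lemma proximate_imp_length_less: "proximate q p \<Longrightarrow> length p < length q"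
  unfolding proximate_def by auto

lemma finite_proximate: "finite {q. proximate p q}"
proof (rule finite_subset)
  show "{q. proximate p q} \<subseteq> (\<lambda>n. take n p) ` {..length p}"
  proof
    fix q assume "q \<in> {q. proximate p q}"
    then obtain r where "p = q @ r" unfolding proximate_def by blast
    then show "q \<in> (\<lambda>n. take n p) ` {..length p}"
      by (intro image_eqI[of _ _ "length q"]) auto
  qed
qed simp

text \<open>
  The recursion \<open>v\<^sub>p = e\<^sub>p + \<Sum>p\<rightarrow>q. v\<^sub>q\<close>, used both for the values of a series and for the virtual
  values of a weighted cluster: a cluster contains every \<open>q\<close> that precedes one of its points \<open>p\<close>, so
  the sum may range over all points \<open>q\<close>.
\<close>

function values_of :: "(point \<Rightarrow> 'a::comm_monoid_add) \<Rightarrow> point \<Rightarrow> 'a" where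
  "values_of e p = e p + (\<Sum>q\<in>{q. proximate p q}. values_of e q)"
  by auto
termination
  by (relation "measure (\<lambda>(e, p). length p)") (auto dest: proximate_imp_length_less)

declare values_of.simps [simp del]

definition value_at :: "point \<Rightarrow> cps \<Rightarrow> enat" where
  "value_at p f = (if f = 0 then \<infinity> else values_of (\<lambda>q. enat (mult_at q f)) p)"


section \<open>Base points of an ideal\<close>

text \<open>The series \<open>0\<close> is left out of the minimum because its multiplicity is infinite.\<close>

definition ideal_mult :: "cps set \<Rightarrow> nat" where
  "ideal_mult \<aa> = (LEAST n. \<exists>f\<in>\<aa>. f \<noteq> 0 \<and> cps_multiplicity f = n)"

text \<open>
  The set in braces is \<open>z^(-e) \<phi>(\<aa>)\<close>, where \<open>\<phi>\<close> is the pull-back, \<open>z\<close> the equation of the exceptional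
  divisor and \<open>e\<close> the multiplicity of \<open>\<aa>\<close>.
\<close>

definition ideal_transform1 :: "direction \<Rightarrow> cps set \<Rightarrow> cps set" where
  "ideal_transform1 d \<aa> =
     ideal.span {g. \<exists>f\<in>\<aa>. pullback d f = exc d ^ ideal_mult \<aa> * g}"

definition ideal_transform :: "point \<Rightarrow> cps set \<Rightarrow> cps set" where
  "ideal_transform p \<aa> = fold ideal_transform1 p \<aa>"

definition ideal_mult_at :: "point \<Rightarrow> cps set \<Rightarrow> nat" where
  "ideal_mult_at p \<aa> = ideal_mult (ideal_transform p \<aa>)"

definition base_points :: "cps set \<Rightarrow> point set" where
  "base_points \<aa> = {p. ideal_mult_at p \<aa> > 0}"

definition base_value :: "cps set \<Rightarrow> point \<Rightarrow> nat" where
  "base_value \<aa> = values_of (\<lambda>p. ideal_mult_at p \<aa>)"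


section \<open>The cluster attached to a system of generators\<close>

definition min_value :: "nat \<Rightarrow> (nat \<Rightarrow> cps) \<Rightarrow> point \<Rightarrow> enat" where
  "min_value r f p = (MIN i\<in>{1..r}. value_at p (f i))"

definition prox_value :: "nat \<Rightarrow> (nat \<Rightarrow> cps) \<Rightarrow> point \<Rightarrow> enat" where
  "prox_value r f p = (if p = [] then 0 else \<Sum>q\<in>{q. proximate p q}. min_value r f q)"

definition value_cluster :: "nat \<Rightarrow> (nat \<Rightarrow> cps) \<Rightarrow> point set" where
  "value_cluster r f = {p. prox_value r f p < min_value r f p}"

end

theory Submission
  imports Defs
begin

text \<open>
  The value \<open>v\<^sub>p(f)\<close> is the multiplicity at \<open>p\<close> of the total transform of \<open>f\<close>, i.e. of the pull-back of
  \<open>f\<close> to the surface that carries \<open>p\<close>. Indeed the total transform is the strict transform times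
  the product of the local equations of the exceptional curves \<open>E\<^sub>q\<close>, each raised to the power \<open>v\<^sub>q(f)\<close>, and
  a strict transform of \<open>E\<^sub>q\<close> has multiplicity 1 at the points proximate to \<open>q\<close> and 0 at the others; so
  taking multiplicities gives exactly the recursion \<open>v\<^sub>p = e\<^sub>p + \<Sum>p\<rightarrow>q. v\<^sub>q\<close>
  (\<open>values_of_eq_exc_factor\<close>, \<open>total_transform_eq_strict_transform\<close>).

  The same factorization holds for ideals: the total transform of \<open>\<aa>\<close> at \<open>p\<close> is the transformed ideal
  times the product of the \<open>E\<^sub>q\<close> raised to the virtual values \<open>\<beta>\<^sub>q\<close> of \<open>\<aa>\<close>, and it is generated by the total
  transforms of any generators of \<open>\<aa>\<close> (\<open>ideal_transform_span\<close>). As the multiplicity of an ideal is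
  the least multiplicity of its generators, \<open>\<beta>\<^sub>p\<close> is the minimum of the \<open>v\<^sub>p(f\<^sub>i)\<close>, at
  \<^emph>\<open>every\<close> infinitely near point \<open>p\<close> and not only at base points (\<open>min_value_eq_base_value\<close>). Hence
  \<open>h\<^sub>p\<close> is \<open>\<beta>\<^sub>p - e\<^sub>p(\<aa>)\<close>, and \<open>h\<^sub>p < v\<^sub>p\<close> says that \<open>e\<^sub>p(\<aa>) > 0\<close>, i.e. that \<open>p\<close> is a base point.

  It remains to see that there are finitely many base points. Only finitely many directions at a point
  can lead to base points, since they are tangent to any element of least multiplicity \<open>e\<close>. Moreover some
  intersection number drops by at least \<open>e\<^sup>2\<close> under each blow-up: one of its two curves is a
  product of coordinate axes, a shape that blow-ups preserve, and the other is kept of multiplicity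
  \<open>e\<close> by adding a general multiple of an element of least multiplicity
  (\<open>finite_base_points_monomial\<close>).
\<close>

section \<open>Coefficients of convergent power series\<close>

lemma cps_eqI: "(\<And>i j. cps_coeff f i j = cps_coeff g i j) \<Longrightarrow> f = g"
  by transfer (auto intro!: fps_ext)

lemma cps_coeff_0 [simp]: "cps_coeff 0 i j = 0"
  by transfer simp

lemma cps_coeff_add [simp]: "cps_coeff (f + g) i j = cps_coeff f i j + cps_coeff g i j"
  by transfer simp

lemma cps_coeff_const_mult [simp]: "cps_coeff (cps_const c * f) i j = c * cps_coeff f i j"
  by transfer simp

lemma cps_coeff_mult:
  "cps_coeff (f * g) i j = (\<Sum>k\<le>i. \<Sum>l\<le>j. cps_coeff f k l * cps_coeff g (i - k) (j - l))"
  by transfer (simp add: fps_mult_nth fps_sum_nth atLeast0AtMost)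

lemma cps_coeff_X_mult: "cps_coeff (cps_X * f) i j = (if i = 0 then 0 else cps_coeff f (i - 1) j)"
  by (simp add: cps_coeff.rep_eq times_cps.rep_eq cps_X.rep_eq fps_X_mult_nth)

lemma cps_coeff_Y_mult: "cps_coeff (cps_Y * f) i j = (if j = 0 then 0 else cps_coeff f i (j - 1))"
  by (simp add: cps_coeff.rep_eq times_cps.rep_eq cps_Y.rep_eq fps_X_mult_nth)

lemma cps_coeff_X_power_mult:
  "cps_coeff (cps_X ^ m * g) i j = (if i < m then 0 else cps_coeff g (i - m) j)"
proof (induction m arbitrary: i)
  case (Suc m)
  show ?case
    unfolding power_Suc mult.assoc cps_coeff_X_mult Suc.IH by (cases i) simp_all
qed simp

lemma cps_coeff_Y_power_mult:
  "cps_coeff (cps_Y ^ m * g) i j = (if j < m then 0 else cps_coeff g i (j - m))"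
proof (induction m arbitrary: j)
  case (Suc m)
  show ?case
    unfolding power_Suc mult.assoc cps_coeff_Y_mult Suc.IH by (cases j) simp_all
qed simp

lift_definition cps_shift_X :: "nat \<Rightarrow> cps \<Rightarrow> cps" is "\<lambda>m F. Abs_fps (\<lambda>i. F $ (i + m))"
proof -
  fix m and F :: "complex fps fps"
  assume "convergent_fps2 F"
  then obtain C R where F: "C \<ge> 0" "R \<ge> 1" "\<And>i j. norm (F $ i $ j) \<le> C * R ^ (i + j)"
    using convergent_fps2E by blast
  show "convergent_fps2 (Abs_fps (\<lambda>i. F $ (i + m)))"
  proof (rule convergent_fps2I[of "C * R ^ m" R])
    show "norm (Abs_fps (\<lambda>i. F $ (i + m)) $ i $ j) \<le> C * R ^ m * R ^ (i + j)" for i j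
      using F(3)[of "i + m" j] by (simp add: power_add mult_ac)
  qed (use F(1,2) in simp_all)
qed

lift_definition cps_shift_Y :: "nat \<Rightarrow> cps \<Rightarrow> cps" is
  "\<lambda>m F. Abs_fps (\<lambda>i. Abs_fps (\<lambda>j. F $ i $ (j + m)))"
proof -
  fix m and F :: "complex fps fps"
  assume "convergent_fps2 F"
  then obtain C R where F: "C \<ge> 0" "R \<ge> 1" "\<And>i j. norm (F $ i $ j) \<le> C * R ^ (i + j)"
    using convergent_fps2E by blast
  show "convergent_fps2 (Abs_fps (\<lambda>i. Abs_fps (\<lambda>j. F $ i $ (j + m))))"
  proof (rule convergent_fps2I[of "C * R ^ m" R])
    show "norm (Abs_fps (\<lambda>i. Abs_fps (\<lambda>j. F $ i $ (j + m))) $ i $ j) \<le> C * R ^ m * R ^ (i + j)" for i j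
      using F(3)[of i "j + m"] by (simp add: power_add mult_ac)
  qed (use F(1,2) in simp_all)
qed

lemma cps_X_power_dvd:
  assumes "\<And>i j. i < m \<Longrightarrow> cps_coeff f i j = 0"
  shows "cps_X ^ m dvd f"
proof
  have "cps_coeff (cps_shift_X m f) i j = cps_coeff f (i + m) j" for i j
    by transfer simp
  then show "f = cps_X ^ m * cps_shift_X m f"
    by (intro cps_eqI) (auto simp: cps_coeff_X_power_mult assms)
qed

lemma cps_Y_power_dvd:
  assumes "\<And>i j. j < m \<Longrightarrow> cps_coeff f i j = 0"
  shows "cps_Y ^ m dvd f"
proof
  have "cps_coeff (cps_shift_Y m f) i j = cps_coeff f i (j + m)" for i j
    by transfer simp
  then show "f = cps_Y ^ m * cps_shift_Y m f"
    by (intro cps_eqI) (auto simp: cps_coeff_Y_power_mult assms)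
qed

section \<open>The pull-back as a ring homomorphism\<close>

lemma cps_coeff_pullback_slope:
  "cps_coeff (pullback_slope t f) n k =
     (\<Sum>j\<le>n. cps_coeff f (n - j) j * ((fps_X + fps_const t) ^ j) $ k)"
  by transfer (simp add: fps_sum_nth)

lemma cps_coeff_pullback_vertical:
  "cps_coeff (pullback_vertical f) i n = (if i \<le> n then cps_coeff f i (n - i) else 0)"
  by transfer simp

lemma cps_coeff_pullback:
  "cps_coeff (pullback d f) i j =
     (case d of Slope t \<Rightarrow> (\<Sum>k\<le>i. cps_coeff f (i - k) k * ((fps_X + fps_const t) ^ k) $ j)
      | Vertical \<Rightarrow> if i \<le> j then cps_coeff f i (j - i) else 0)"
  by (cases d) (simp_all add: cps_coeff_pullback_slope cps_coeff_pullback_vertical)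

lemma pullback_0 [simp]: "pullback d 0 = 0"
  by (rule cps_eqI) (simp add: cps_coeff_pullback split: direction.split)

lemma pullback_add: "pullback d (f + g) = pullback d f + pullback d g"
  by (rule cps_eqI)
    (simp add: cps_coeff_pullback sum.distrib algebra_simps split: direction.split)

text \<open>
  The coefficient of \<open>x^n\<close> in \<open>f (x, x (y + t))\<close> is the homogeneous part of degree \<open>n\<close> of \<open>f\<close>, evaluated at
  \<open>(1, y + t)\<close>. Multiplicativity is thus the statement that the part of degree \<open>n\<close> of a product is the sum
  of the products of the parts whose degrees add up to \<open>n\<close>.
\<close>

lemma pullback_slope_mult: "pullback_slope t (f * g) = pullback_slope t f * pullback_slope t g"
proof transfer
  fix t :: complex and F G :: "complex fps fps"
  define P where "P = fps_X + fps_const t"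
  define T where "T = (\<lambda>a b c d. fps_const (F $ a $ b) * fps_const (G $ c $ d) * P ^ (b + d))"
  have "(\<Sum>j\<le>n. fps_const ((F * G) $ (n - j) $ j) * P ^ j) =
        (\<Sum>m\<le>n. (\<Sum>j\<le>m. fps_const (F $ (m - j) $ j) * P ^ j) *
          (\<Sum>j\<le>n - m. fps_const (G $ (n - m - j) $ j) * P ^ j))" for n
  proof -
    have "(\<Sum>j\<le>n. fps_const ((F * G) $ (n - j) $ j) * P ^ j) =
        (\<Sum>j\<le>n. \<Sum>k\<le>n - j. \<Sum>l\<le>j. T k l (n - j - k) (j - l))"
    proof (rule sum.cong[OF refl])
      fix j assume "j \<in> {..n}"
      have *: "fps_const (\<Sum>i\<in>A. h i) = (\<Sum>i\<in>A. fps_const (h i))"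
        for A :: "nat set" and h :: "nat \<Rightarrow> complex"
        by (induction A rule: infinite_finite_induct) (auto simp flip: fps_const_add)
      show "fps_const ((F * G) $ (n - j) $ j) * P ^ j =
          (\<Sum>k\<le>n - j. \<Sum>l\<le>j. T k l (n - j - k) (j - l))"
        by (auto simp: fps_mult_nth fps_sum_nth atLeast0AtMost * sum_distrib_right T_def
            intro!: sum.cong)
    qed
    also have "\<dots> = (\<Sum>(j, k, l)\<in>(SIGMA j:{..n}. {..n - j} \<times> {..j}). T k l (n - j - k) (j - l))"
      by (simp add: sum.Sigma sum.cartesian_product split_def)
    \<comment> \<open>A term is indexed by two monomials; the new index \<open>m = k + l\<close> is the degree of the first one.\<close>
    also have "\<dots> = (\<Sum>(m, j, j')\<in>(SIGMA m:{..n}. {..m} \<times> {..n - m}).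
        T (m - j) j (n - m - j') j')"
      by (rule sum.reindex_bij_witness
          [of _ "\<lambda>(m, j, j'). (j + j', m - j, j)" "\<lambda>(j, k, l). (k + l, l, j - l)"])
        (auto simp: add.commute)
    also have "\<dots> = (\<Sum>m\<le>n. \<Sum>j\<le>m. \<Sum>j'\<le>n - m. T (m - j) j (n - m - j') j')"
      by (simp add: sum.Sigma sum.cartesian_product split_def)
    also have "\<dots> = (\<Sum>m\<le>n. (\<Sum>j\<le>m. fps_const (F $ (m - j) $ j) * P ^ j) *
          (\<Sum>j\<le>n - m. fps_const (G $ (n - m - j) $ j) * P ^ j))"
      by (simp add: sum_product T_def power_add algebra_simps)
    finally show ?thesis .
  qed
  then show "Abs_fps (\<lambda>n. \<Sum>j\<le>n. fps_const ((F * G) $ (n - j) $ j) * (fps_X + fps_const t) ^ j) =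
      Abs_fps (\<lambda>n. \<Sum>j\<le>n. fps_const (F $ (n - j) $ j) * (fps_X + fps_const t) ^ j) *
      Abs_fps (\<lambda>n. \<Sum>j\<le>n. fps_const (G $ (n - j) $ j) * (fps_X + fps_const t) ^ j)"
    by (intro fps_ext) (simp add: fps_mult_nth atLeast0AtMost flip: P_def)
qed

lemma pullback_vertical_mult:
  "pullback_vertical (f * g) = pullback_vertical f * pullback_vertical g"
proof (rule cps_eqI)
  fix i n
  let ?F = "\<lambda>k m. if k \<le> m then cps_coeff f k (m - k) else 0"
  let ?G = "\<lambda>k m. if k \<le> m then cps_coeff g k (m - k) else 0"
  have "(\<Sum>m\<le>n. ?F k m * ?G (i - k) (n - m)) =
     (if i \<le> n then \<Sum>l\<le>n - i. cps_coeff f k l * cps_coeff g (i - k) (n - i - l) else 0)"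
    if "k \<le> i" for k
  proof (cases "i \<le> n")
    case True
    have "(\<Sum>l\<le>n - i. cps_coeff f k l * cps_coeff g (i - k) (n - i - l)) =
        (\<Sum>m\<in>{k..n - (i - k)}. ?F k m * ?G (i - k) (n - m))"
      by (rule sum.reindex_bij_witness[of _ "\<lambda>m. m - k" "\<lambda>l. l + k"])
        (use that True in \<open>auto simp: algebra_simps\<close>)
    also have "\<dots> = (\<Sum>m\<le>n. ?F k m * ?G (i - k) (n - m))"
      by (rule sum.mono_neutral_left) (use that True in auto)
    finally show ?thesis using True by simp
  next
    case False
    then have "(\<Sum>m\<le>n. ?F k m * ?G (i - k) (n - m)) = 0"
      by (intro sum.neutral) (use that in auto)
    then show ?thesis using False by simp
  qed
  then show "cps_coeff (pullback_vertical (f * g)) i n =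
      cps_coeff (pullback_vertical f * pullback_vertical g) i n"
    by (simp add: cps_coeff_pullback_vertical cps_coeff_mult)
qed

lemma pullback_mult: "pullback d (f * g) = pullback d f * pullback d g"
  by (cases d) (simp_all add: pullback_slope_mult pullback_vertical_mult)

section \<open>Multiplicities\<close>

lemma cps_multiplicity_le: "cps_coeff f i j \<noteq> 0 \<Longrightarrow> cps_multiplicity f \<le> i + j"
  unfolding cps_multiplicity_def by (rule Least_le) blast

lemma cps_multiplicity_attained:
  assumes "f \<noteq> 0"
  obtains i j where "i + j = cps_multiplicity f" "cps_coeff f i j \<noteq> 0"
proof -
  obtain i j where "cps_coeff f i j \<noteq> 0"
    using assms cps_eqI[of f 0] by auto
  then have "\<exists>n i j. i + j = n \<and> cps_coeff f i j \<noteq> 0" by blast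
  then have "\<exists>i j. i + j = cps_multiplicity f \<and> cps_coeff f i j \<noteq> 0"
    unfolding cps_multiplicity_def by (rule LeastI_ex)
  then show ?thesis using that by blast
qed

lemma cps_coeff_below_multiplicity: "i + j < cps_multiplicity f \<Longrightarrow> cps_coeff f i j = 0"
  using cps_multiplicity_le[of f i j] by linarith

lemma cps_multiplicity_ge:
  assumes "f \<noteq> 0" "\<And>i j. i + j < n \<Longrightarrow> cps_coeff f i j = 0"
  shows "n \<le> cps_multiplicity f"
  using assms cps_multiplicity_attained[OF assms(1)] by (metis leI)

lemma cps_multiplicity_eq_0_iff:
  "f \<noteq> 0 \<Longrightarrow> cps_multiplicity f = 0 \<longleftrightarrow> cps_coeff f 0 0 \<noteq> 0"
  by (metis add_is_0 cps_multiplicity_attained cps_multiplicity_le le_0_eq add_0)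

lemma nth_power_X_plus_const:
  "k \<le> j \<Longrightarrow> ((fps_X + fps_const t) ^ k :: complex fps) $ j = (if j = k then 1 else 0)"
proof (induction k arbitrary: j)
  case (Suc k)
  have "((fps_X + fps_const t) ^ Suc k :: complex fps) $ j =
      ((fps_X + fps_const t) ^ k) $ (j - 1) + t * ((fps_X + fps_const t) ^ k) $ j"
    using Suc.prems by (simp add: distrib_right)
  then show ?case
    using Suc.IH[of "j - 1"] Suc.IH[of j] Suc.prems by auto
qed simp

text \<open>
  A monomial of degree \<open>n\<close> in \<open>x\<close> and \<open>y\<close> pulls back to a multiple of the \<open>n\<close>-th power of the
  exceptional equation.
\<close>

lemma exc_power_dvd_pullback:
  assumes "\<And>i j. i + j < n \<Longrightarrow> cps_coeff f i j = 0"
  shows "exc d ^ n dvd pullback d f"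
proof (cases d)
  case (Slope t)
  then show ?thesis
    by (auto simp: cps_coeff_pullback_slope assms intro!: cps_X_power_dvd sum.neutral)
next
  case Vertical
  then show ?thesis
    by (auto simp: cps_coeff_pullback_vertical assms intro!: cps_Y_power_dvd)
qed

text \<open>
  The Taylor coefficients of the restriction of a series to the exceptional divisor through the point of
  direction \<open>d\<close>, which is the \<open>y\<close>-axis for a slope and the \<open>x\<close>-axis for the vertical direction.
\<close>

fun on_exceptional :: "direction \<Rightarrow> cps \<Rightarrow> nat \<Rightarrow> complex" where
  "on_exceptional (Slope t) f k = cps_coeff f 0 k"
| "on_exceptional Vertical f k = cps_coeff f k 0"

text \<open>
  Restricted to the exceptional divisor, the quotient is the homogeneous part of degree \<open>i + j\<close> of \<open>f\<close>,
  dehomogenized at \<open>d\<close>: a nonzero polynomial of degree at most \<open>i + j\<close>. This is why multiplicities do not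
  increase under blow-ups, and it also bounds the intersection number with the exceptional divisor in the
  finiteness proof.
\<close>

lemma on_exceptional_weak_transform:
  assumes "cps_coeff f i j \<noteq> 0" "pullback d f = exc d ^ (i + j) * g"
  obtains k where "k \<le> i + j" "on_exceptional d g k \<noteq> 0"
proof (cases d)
  case (Slope t)
  \<comment> \<open>In the powers of \<open>y + t\<close>, the term of highest degree \<open>J\<close> cannot cancel.\<close>
  define J where "J = Max {k. k \<le> i + j \<and> cps_coeff f (i + j - k) k \<noteq> 0}"
  have "J \<in> {k. k \<le> i + j \<and> cps_coeff f (i + j - k) k \<noteq> 0}"
    unfolding J_def by (rule Max_in) (use assms(1) in \<open>auto intro!: exI[of _ j]\<close>)
  then have J: "J \<le> i + j" "cps_coeff f (i + j - J) J \<noteq> 0" by auto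
  have J_max: "k \<le> J" if "k \<le> i + j" "cps_coeff f (i + j - k) k \<noteq> 0" for k
    unfolding J_def by (rule Max_ge) (use that in auto)
  have "cps_coeff g 0 J = cps_coeff (pullback d f) (i + j) J"
    unfolding assms(2) by (simp add: Slope cps_coeff_X_power_mult)
  also have "\<dots> = (\<Sum>k\<le>i + j. if k = J then cps_coeff f (i + j - J) J else 0)"
    unfolding Slope pullback.simps cps_coeff_pullback_slope
  proof (rule sum.cong[OF refl])
    fix k assume "k \<in> {..i + j}"
    then show "cps_coeff f (i + j - k) k * ((fps_X + fps_const t) ^ k) $ J =
        (if k = J then cps_coeff f (i + j - J) J else 0)"
      using J_max[of k] by (cases "k \<le> J") (auto simp: nth_power_X_plus_const)
  qed
  also have "\<dots> \<noteq> 0" using J by simp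
  finally show ?thesis using that[of J] J Slope by simp
next
  case Vertical
  have "cps_coeff g i 0 = cps_coeff (pullback d f) i (i + j)"
    unfolding assms(2) by (simp add: Vertical cps_coeff_Y_power_mult)
  also have "\<dots> = cps_coeff f i j"
    by (simp add: Vertical cps_coeff_pullback_vertical)
  finally show ?thesis using that[of i] assms(1) Vertical by simp
qed

lemma on_exceptional_0 [simp]: "on_exceptional d 0 k = 0"
  by (cases d) simp_all

lemma cps_multiplicity_le_on_exceptional:
  "on_exceptional d f k \<noteq> 0 \<Longrightarrow> cps_multiplicity f \<le> k"
  using cps_multiplicity_le[of f 0 k] cps_multiplicity_le[of f k 0] by (cases d) auto

lemma pullback_eq_0_iff [simp]: "pullback d f = 0 \<longleftrightarrow> f = 0"
proof
  assume *: "pullback d f = 0"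
  show "f = 0"
  proof (rule ccontr)
    assume "f \<noteq> 0"
    then obtain i j where "cps_coeff f i j \<noteq> 0" using cps_multiplicity_attained by blast
    then obtain k where "on_exceptional d 0 k \<noteq> 0"
      using on_exceptional_weak_transform[of f i j d 0] * by auto
    then show False by simp
  qed
qed simp

lemma pullback_1 [simp]: "pullback d 1 = 1"
proof -
  \<comment> \<open>A nonzero idempotent of a domain is \<open>1\<close>.\<close>
  have "pullback d 1 * pullback d 1 = pullback d 1 * 1"
    by (simp flip: pullback_mult)
  then show ?thesis
    by (simp only: mult_left_cancel pullback_eq_0_iff one_neq_zero not_False_eq_True
        mult_cancel_left simp_thms)
qed

lemma pullback_power: "pullback d (f ^ n) = pullback d f ^ n"
  by (induction n) (simp_all add: pullback_mult)

lemma pullback_prod: "pullback d (prod f A) = (\<Prod>x\<in>A. pullback d (f x))"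
  by (induction A rule: infinite_finite_induct) (simp_all add: pullback_mult)

lemma cps_coeff_0_0_pullback: "cps_coeff (pullback d f) 0 0 = cps_coeff f 0 0"
  by (simp add: cps_coeff_pullback split: direction.split)

lemma cps_coeff_0_0_mult [simp]:
  "cps_coeff (f * g) 0 0 = cps_coeff f 0 0 * cps_coeff g 0 0"
  by (simp add: cps_coeff_mult)

lemma cps_coeff_mult_below:
  assumes "\<And>i j. i + j < m \<Longrightarrow> cps_coeff f i j = 0" "\<And>i j. i + j < n \<Longrightarrow> cps_coeff g i j = 0"
    and "i + j < m + n"
  shows "cps_coeff (f * g) i j = 0"
  unfolding cps_coeff_mult
proof (intro sum.neutral ballI)
  fix k l assume "k \<in> {..i}" "l \<in> {..j}"
  then have "k + l < m \<or> (i - k) + (j - l) < n" using assms(3) by auto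
  then show "cps_coeff f k l * cps_coeff g (i - k) (j - l) = 0" using assms by auto
qed

text \<open>
  Dividing the pull-backs of \<open>f\<close> and \<open>g\<close> in the direction of slope 0 by the powers of \<open>x\<close> that belong to
  the multiplicities leaves series with nonzero restriction to \<open>x = 0\<close>. These restrictions are power series
  in one variable, so their product is nonzero too; it is the dehomogenized part of degree
  \<open>m + n\<close> of \<open>f g\<close>.
\<close>

lemma cps_multiplicity_mult:
  assumes "f \<noteq> 0" "g \<noteq> 0"
  shows "cps_multiplicity (f * g) = cps_multiplicity f + cps_multiplicity g"
proof (rule antisym)
  let ?m = "cps_multiplicity f" and ?n = "cps_multiplicity g"
  show "?m + ?n \<le> cps_multiplicity (f * g)"
    by (intro cps_multiplicity_ge cps_coeff_mult_below[where m = ?m and n = ?n])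
      (use assms in \<open>auto simp: cps_coeff_below_multiplicity\<close>)
  have row: "\<exists>f'. pullback_slope 0 f = cps_X ^ cps_multiplicity f * f' \<and> Rep_cps f' $ 0 \<noteq> 0"
    if nz: "f \<noteq> 0" for f
  proof -
    obtain i j where ij: "i + j = cps_multiplicity f" "cps_coeff f i j \<noteq> 0"
      using cps_multiplicity_attained[OF nz] by blast
    have "exc (Slope 0) ^ cps_multiplicity f dvd pullback (Slope 0) f"
      by (rule exc_power_dvd_pullback[OF cps_coeff_below_multiplicity])
    then obtain f' where f': "pullback (Slope 0) f = exc (Slope 0) ^ cps_multiplicity f * f'"
      by (rule dvdE)
    then have "pullback (Slope 0) f = exc (Slope 0) ^ (i + j) * f'"
      by (simp only: ij(1))
    with ij(2) obtain k where "on_exceptional (Slope 0) f' k \<noteq> 0"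
      using on_exceptional_weak_transform by blast
    then have "Rep_cps f' $ 0 \<noteq> 0" by (auto simp: cps_coeff.rep_eq)
    with f' show ?thesis by (intro exI[of _ f']) simp
  qed
  obtain f' where f': "pullback_slope 0 f = cps_X ^ ?m * f'" "Rep_cps f' $ 0 \<noteq> 0"
    using row[OF assms(1)] by (elim exE conjE)
  obtain g' where g': "pullback_slope 0 g = cps_X ^ ?n * g'" "Rep_cps g' $ 0 \<noteq> 0"
    using row[OF assms(2)] by (elim exE conjE)
  have "Rep_cps (f' * g') $ 0 \<noteq> 0"
    using f'(2) g'(2) by (simp add: times_cps.rep_eq)
  then obtain k where k: "cps_coeff (f' * g') 0 k \<noteq> 0"
    by (auto simp: cps_coeff.rep_eq fps_eq_iff)
  have "pullback_slope 0 (f * g) = cps_X ^ (?m + ?n) * (f' * g')"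
    by (simp add: pullback_slope_mult f'(1) g'(1) power_add)
  then have "cps_coeff (pullback_slope 0 (f * g)) (?m + ?n) k \<noteq> 0"
    using k by (simp only: cps_coeff_X_power_mult) simp
  then obtain j where "j \<le> ?m + ?n" "cps_coeff (f * g) (?m + ?n - j) j \<noteq> 0"
    unfolding cps_coeff_pullback_slope by (metis (no_types, lifting) atMost_iff mult_zero_left sum.neutral)
  then show "cps_multiplicity (f * g) \<le> ?m + ?n"
    using cps_multiplicity_le[of "f * g" "?m + ?n - j" j] by simp
qed

lemma cps_multiplicity_1 [simp]: "cps_multiplicity 1 = 0"
  using cps_multiplicity_mult[of 1 1] by simp

lemma cps_multiplicity_power: "f \<noteq> 0 \<Longrightarrow> cps_multiplicity (f ^ n) = n * cps_multiplicity f"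
  by (induction n) (simp_all add: cps_multiplicity_mult)

lemma cps_multiplicity_prod:
  "(\<And>x. x \<in> A \<Longrightarrow> f x \<noteq> 0) \<Longrightarrow> cps_multiplicity (prod f A) = (\<Sum>x\<in>A. cps_multiplicity (f x))"
  by (induction A rule: infinite_finite_induct) (simp_all add: cps_multiplicity_mult)

lemma cps_coeff_X: "cps_coeff cps_X i j = (if i = 1 \<and> j = 0 then 1 else 0)"
  by transfer (auto simp: fps_X_def)

lemma cps_coeff_Y: "cps_coeff cps_Y i j = (if i = 0 \<and> j = 1 then 1 else 0)"
  by transfer (auto simp: fps_X_def fps_const_def)

lemma exc_neq_0 [simp]: "exc d \<noteq> 0"
proof
  assume "exc d = 0"
  then have "cps_coeff (exc d) i j = 0" for i j by simp
  from this[of 1 0] this[of 0 1] show False by (cases d) (auto simp: cps_coeff_X cps_coeff_Y)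
qed

lemma cps_multiplicity_exc: "cps_multiplicity (exc d) = 1"
proof (rule antisym)
  show "cps_multiplicity (exc d) \<le> 1"
    using cps_multiplicity_le[of "exc d" 1 0] cps_multiplicity_le[of "exc d" 0 1]
    by (cases d) (auto simp: cps_coeff_X cps_coeff_Y)
  have "cps_coeff (exc d) 0 0 = 0" by (cases d) (auto simp: cps_coeff_X cps_coeff_Y)
  then show "1 \<le> cps_multiplicity (exc d)"
    using cps_multiplicity_eq_0_iff[of "exc d"] by simp
qed

section \<open>Strict transforms\<close>

lemma strict_transform1_unique:
  "pullback d f = exc d ^ cps_multiplicity f * g \<Longrightarrow> strict_transform1 d f = g"
  unfolding strict_transform1_def by (rule the_equality) auto

lemma pullback_eq_strict_transform1:
  "pullback d f = exc d ^ cps_multiplicity f * strict_transform1 d f"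
proof -
  have "exc d ^ cps_multiplicity f dvd pullback d f"
    by (rule exc_power_dvd_pullback[OF cps_coeff_below_multiplicity])
  then obtain g where g: "pullback d f = exc d ^ cps_multiplicity f * g"
    by (rule dvdE)
  then show ?thesis
    using strict_transform1_unique by blast
qed

lemma strict_transform1_neq_0: "f \<noteq> 0 \<Longrightarrow> strict_transform1 d f \<noteq> 0"
  using pullback_eq_strict_transform1[of d f] by auto

lemma cps_multiplicity_strict_transform1:
  assumes "f \<noteq> 0"
  shows "cps_multiplicity (strict_transform1 d f) \<le> cps_multiplicity f"
proof -
  obtain i j where ij: "i + j = cps_multiplicity f" "cps_coeff f i j \<noteq> 0"
    using cps_multiplicity_attained[OF assms] by blast
  have "pullback d f = exc d ^ (i + j) * strict_transform1 d f"
    unfolding ij(1) by (rule pullback_eq_strict_transform1)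
  with ij(2) obtain k where k: "k \<le> i + j" "on_exceptional d (strict_transform1 d f) k \<noteq> 0"
    using on_exceptional_weak_transform by blast
  show ?thesis
    using cps_multiplicity_le_on_exceptional[OF k(2)] k(1) ij(1) by simp
qed

lemma strict_transform_Nil [simp]: "strict_transform [] f = f"
  by (simp add: strict_transform_def)

lemma strict_transform_snoc [simp]:
  "strict_transform (p @ [d]) f = strict_transform1 d (strict_transform p f)"
  by (simp add: strict_transform_def)

lemma strict_transform_neq_0: "f \<noteq> 0 \<Longrightarrow> strict_transform p f \<noteq> 0"
  by (induction p rule: rev_induct) (simp_all add: strict_transform1_neq_0)

lemma cps_multiplicity_strict_transform:
  "f \<noteq> 0 \<Longrightarrow> cps_multiplicity (strict_transform p f) \<le> cps_multiplicity f"
proof (induction p rule: rev_induct)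
  case (snoc d p)
  then show ?case
    using cps_multiplicity_strict_transform1[OF strict_transform_neq_0[of f p], of d] by simp
qed simp

section \<open>Values as multiplicities of total transforms\<close>

definition total_transform :: "point \<Rightarrow> cps \<Rightarrow> cps" where
  "total_transform p f = fold pullback p f"

lemma total_transform_Nil [simp]: "total_transform [] f = f"
  by (simp add: total_transform_def)

lemma total_transform_snoc [simp]:
  "total_transform (p @ [d]) f = pullback d (total_transform p f)"
  by (simp add: total_transform_def)

lemma total_transform_eq_0_iff [simp]: "total_transform p f = 0 \<longleftrightarrow> f = 0"
  by (induction p rule: rev_induct) simp_all

text \<open>
  The strict transform at \<open>p\<close> of the exceptional divisor \<open>E\<^sub>q\<close>, where \<open>q = take n p\<close>; it is a unit when this
  divisor does not pass through \<open>p\<close>.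
\<close>

definition exc_branch :: "nat \<Rightarrow> point \<Rightarrow> cps" where
  "exc_branch n p = strict_transform (drop (Suc n) p) (exc (p ! n))"

lemma exc_branch_neq_0 [simp]: "exc_branch n p \<noteq> 0"
  by (simp add: exc_branch_def strict_transform_neq_0)

lemma exc_branch_snoc:
  "n < length p \<Longrightarrow> exc_branch n (p @ [d]) = strict_transform1 d (exc_branch n p)"
  by (simp add: exc_branch_def nth_append)

lemma exc_branch_last: "exc_branch (length p) (p @ [d]) = exc d"
  by (simp add: exc_branch_def)

lemma cps_multiplicity_exc_branch: "cps_multiplicity (exc_branch n p) \<le> 1"
  using cps_multiplicity_strict_transform[of "exc (p ! n)"]
  by (simp add: exc_branch_def cps_multiplicity_exc)

lemma proximate_iff_exc_branch:
  "proximate p q \<longleftrightarrow> (\<exists>n<length p. q = take n p \<and> cps_multiplicity (exc_branch n p) = 1)"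
proof -
  have eq: "cps_multiplicity (exc_branch n p) = 1 \<longleftrightarrow> cps_coeff (exc_branch n p) 0 0 = 0" for n
    using cps_multiplicity_exc_branch[of n p] cps_multiplicity_eq_0_iff[of "exc_branch n p"]
    by (metis exc_branch_neq_0 le_neq_implies_less less_one zero_neq_one)
  show ?thesis
  proof
    assume "proximate p q"
    then obtain d ds where "p = q @ d # ds" "cps_coeff (strict_transform ds (exc d)) 0 0 = 0"
      unfolding proximate_def by blast
    then show "\<exists>n<length p. q = take n p \<and> cps_multiplicity (exc_branch n p) = 1"
      unfolding eq by (intro exI[of _ "length q"]) (simp add: exc_branch_def)
  next
    assume "\<exists>n<length p. q = take n p \<and> cps_multiplicity (exc_branch n p) = 1"
    then obtain n where n: "n < length p" "q = take n p" "cps_coeff (exc_branch n p) 0 0 = 0"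
      unfolding eq by blast
    show "proximate p q"
      unfolding proximate_def
      by (intro exI[of _ "p ! n"] exI[of _ "drop (Suc n) p"])
        (use n in \<open>simp add: exc_branch_def id_take_nth_drop[symmetric]\<close>)
  qed
qed

text \<open>
  The multiplicity of \<open>exc_branch n p\<close> is 1 or 0 according to whether \<open>p\<close> is proximate to \<open>take n p\<close>, so
  the sum over proximate points can be extended to all points preceding \<open>p\<close>. In this form it compares
  well with the multiplicity of a product.
\<close>

lemma values_of_exc_branch:
  fixes e :: "point \<Rightarrow> nat"
  shows "values_of e p =
    e p + (\<Sum>n<length p. cps_multiplicity (exc_branch n p) * values_of e (take n p))"
proof -
  let ?N = "{n. n < length p \<and> cps_multiplicity (exc_branch n p) = 1}"
  have inj: "inj_on (\<lambda>n. take n p) ?N"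
    by (rule inj_on_inverseI[of _ length]) auto
  have "{q. proximate p q} = (\<lambda>n. take n p) ` ?N"
    unfolding proximate_iff_exc_branch by auto
  then have "(\<Sum>q\<in>{q. proximate p q}. values_of e q) = (\<Sum>n\<in>?N. values_of e (take n p))"
    using inj by (simp add: sum.reindex)
  also have "\<dots> = (\<Sum>n\<in>?N. cps_multiplicity (exc_branch n p) * values_of e (take n p))"
    by (intro sum.cong) auto
  also have "\<dots> = (\<Sum>n<length p. cps_multiplicity (exc_branch n p) * values_of e (take n p))"
  proof (rule sum.mono_neutral_left)
    show "\<forall>n\<in>{..<length p} - ?N. cps_multiplicity (exc_branch n p) * values_of e (take n p) = 0"
      using cps_multiplicity_exc_branch[of _ p] by (force simp: le_Suc_eq)
  qed auto
  finally show ?thesis using values_of.simps[of e p] by simp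
qed

text \<open>
  The exceptional part of the total transform at \<open>p\<close> of a curve or of an ideal with multiplicities
  \<open>e\<close>.
\<close>

definition exc_factor :: "(point \<Rightarrow> nat) \<Rightarrow> point \<Rightarrow> cps" where
  "exc_factor e p = (\<Prod>n<length p. exc_branch n p ^ values_of e (take n p))"

lemma exc_factor_Nil [simp]: "exc_factor e [] = 1"
  by (simp add: exc_factor_def)

lemma exc_factor_neq_0 [simp]: "exc_factor e p \<noteq> 0"
  by (simp add: exc_factor_def)

lemma values_of_eq_exc_factor: "values_of e p = cps_multiplicity (exc_factor e p) + e p"
proof -
  have "cps_multiplicity (exc_factor e p) =
      (\<Sum>n<length p. cps_multiplicity (exc_branch n p) * values_of e (take n p))"
    unfolding exc_factor_def
    by (subst cps_multiplicity_prod) (simp_all add: cps_multiplicity_power mult.commute)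
  then show ?thesis using values_of_exc_branch[of e p] by simp
qed

text \<open>
  The new exceptional divisor enters the total transform with a contribution from every curve through \<open>p\<close>:
  multiplicity times value for each exceptional branch, and \<open>e p\<close> for the curve or ideal itself. By the
  recursion for values these add up to the value at \<open>p\<close>.
\<close>

lemma exc_factor_snoc: "exc_factor e (p @ [d]) = pullback d (exc_factor e p) * exc d ^ e p"
proof -
  let ?m = "\<lambda>n. cps_multiplicity (exc_branch n p)"
  let ?v = "\<lambda>n. values_of e (take n p)"
  let ?Q = "\<Prod>n<length p. strict_transform1 d (exc_branch n p) ^ ?v n"
  have "pullback d (exc_factor e p) =
      (\<Prod>n<length p. (exc d ^ ?m n * strict_transform1 d (exc_branch n p)) ^ ?v n)"
    unfolding exc_factor_def pullback_prod pullback_power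
    by (intro prod.cong refl arg_cong[where f = "\<lambda>x. x ^ _"] pullback_eq_strict_transform1)
  also have "\<dots> = (\<Prod>n<length p. exc d ^ (?m n * ?v n)) * ?Q"
    by (simp only: power_mult_distrib prod.distrib power_mult)
  also have "(\<Prod>n<length p. exc d ^ (?m n * ?v n)) = exc d ^ (\<Sum>n<length p. ?m n * ?v n)"
    by (rule power_sum[symmetric])
  finally have "pullback d (exc_factor e p) * exc d ^ e p = ?Q * exc d ^ values_of e p"
    unfolding values_of_exc_branch[of e p] power_add by (simp only: mult_ac)
  moreover have "exc_factor e (p @ [d]) = ?Q * exc d ^ values_of e p"
    unfolding exc_factor_def by (simp add: exc_branch_snoc exc_branch_last)
  ultimately show ?thesis by simp
qed

lemma total_transform_eq_strict_transform:
  "total_transform p f = exc_factor (\<lambda>q. mult_at q f) p * strict_transform p f"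
proof (induction p rule: rev_induct)
  case (snoc d p)
  have "total_transform (p @ [d]) f =
      pullback d (exc_factor (\<lambda>q. mult_at q f) p) * pullback d (strict_transform p f)"
    by (simp only: total_transform_snoc snoc.IH pullback_mult)
  also have "pullback d (strict_transform p f) =
      exc d ^ mult_at p f * strict_transform (p @ [d]) f"
    unfolding mult_at_def strict_transform_snoc by (rule pullback_eq_strict_transform1)
  finally show ?case by (simp only: exc_factor_snoc mult_ac)
qed simp

lemma sum_enat: "(\<Sum>x\<in>A. enat (h x)) = enat (sum h A)"
  by (induction A rule: infinite_finite_induct) (auto simp: zero_enat_def)

lemma values_of_enat: "values_of (\<lambda>q. enat (e q)) p = enat (values_of e p)"
proof (induction p rule: length_induct)
  case (1 p)
  have "(\<Sum>q\<in>{q. proximate p q}. values_of (\<lambda>q. enat (e q)) q) =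
      (\<Sum>q\<in>{q. proximate p q}. enat (values_of e q))"
    using 1 by (intro sum.cong) (auto dest: proximate_imp_length_less)
  then show ?case
    by (simp add: values_of.simps[of _ p] sum_enat)
qed

lemma value_at_eq_total_transform:
  "f \<noteq> 0 \<Longrightarrow> value_at p f = enat (cps_multiplicity (total_transform p f))"
  unfolding value_at_def total_transform_eq_strict_transform
  by (simp add: values_of_enat values_of_eq_exc_factor cps_multiplicity_mult strict_transform_neq_0
      mult_at_def)

section \<open>Multiplicities and transforms of generated ideals\<close>

lemma ideal_mult_eqI:
  assumes "f \<in> S" "f \<noteq> 0" "\<And>g. g \<in> S \<Longrightarrow> g \<noteq> 0 \<Longrightarrow> cps_multiplicity f \<le> cps_multiplicity g"
  shows "ideal_mult S = cps_multiplicity f"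
  unfolding ideal_mult_def by (rule Least_equality) (use assms in auto)

lemma ideal_mult_le: "f \<in> S \<Longrightarrow> f \<noteq> 0 \<Longrightarrow> ideal_mult S \<le> cps_multiplicity f"
  unfolding ideal_mult_def by (rule Least_le) blast

lemma ideal_mult_attained:
  assumes "\<not> S \<subseteq> {0}"
  obtains f where "f \<in> S" "f \<noteq> 0" "cps_multiplicity f = ideal_mult S"
proof -
  have "\<exists>n. \<exists>f\<in>S. f \<noteq> 0 \<and> cps_multiplicity f = n" using assms by auto
  then have "\<exists>f\<in>S. f \<noteq> 0 \<and> cps_multiplicity f = ideal_mult S"
    unfolding ideal_mult_def by (rule LeastI_ex)
  then show ?thesis using that by blast
qed

lemma cps_coeff_below_ideal_mult:
  assumes "f \<in> S" "i + j < ideal_mult S"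
  shows "cps_coeff f i j = 0"
proof (cases "f = 0")
  case False
  then show ?thesis
    using ideal_mult_le[OF assms(1)] assms(2) by (auto intro: cps_coeff_below_multiplicity)
qed simp

lemma cps_coeff_mult_below_left:
  assumes "\<And>i j. i + j < n \<Longrightarrow> cps_coeff g i j = 0" "i + j < n"
  shows "cps_coeff (f * g) i j = 0"
  using cps_coeff_mult_below[of 0 f n g i j] assms by simp

text \<open>
  The series of multiplicity at least \<open>n\<close> form an ideal, so no nonzero element of the generated ideal
  can have smaller multiplicity than all the generators.
\<close>

lemma ideal_mult_span:
  assumes "\<not> S \<subseteq> {0}"
  shows "ideal_mult (ideal.span S) = ideal_mult S"
proof -
  obtain f where f: "f \<in> S" "f \<noteq> 0" "cps_multiplicity f = ideal_mult S"
    using ideal_mult_attained[OF assms] .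
  have "ideal.subspace {g. \<forall>i j. i + j < ideal_mult S \<longrightarrow> cps_coeff g i j = 0}"
    by (rule ideal.subspaceI) (auto intro: cps_coeff_mult_below_left)
  then have "ideal.span S \<subseteq> {g. \<forall>i j. i + j < ideal_mult S \<longrightarrow> cps_coeff g i j = 0}"
    by (rule ideal.span_minimal[rotated]) (auto intro: cps_coeff_below_ideal_mult)
  then have "ideal_mult (ideal.span S) = cps_multiplicity f"
    by (intro ideal_mult_eqI cps_multiplicity_ge)
      (use f in \<open>auto intro: ideal.span_base\<close>)
  then show ?thesis using f by simp
qed

lemma ideal_mult_times_image:
  assumes "\<not> S \<subseteq> {0}" "c \<noteq> 0"
  shows "ideal_mult ((*) c ` S) = cps_multiplicity c + ideal_mult S"
proof -
  obtain f where f: "f \<in> S" "f \<noteq> 0" "cps_multiplicity f = ideal_mult S"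
    using ideal_mult_attained[OF assms(1)] .
  have "ideal_mult ((*) c ` S) = cps_multiplicity (c * f)"
    by (rule ideal_mult_eqI)
      (use f assms(2) in \<open>auto simp: cps_multiplicity_mult ideal_mult_le\<close>)
  then show ?thesis using f assms(2) by (simp add: cps_multiplicity_mult)
qed

text \<open>
  Each pulled back generator is divisible by the exceptional power, hence a linear combination of generators
  can be divided summand by summand.
\<close>

lemma ideal_transform1_span:
  assumes "\<not> S \<subseteq> {0}"
  shows "ideal_transform1 d (ideal.span S) =
    ideal.span {g. \<exists>f\<in>S. pullback d f = exc d ^ ideal_mult S * g}"
    (is "_ = ideal.span ?G")
proof -
  let ?z = "exc d ^ ideal_mult S"
  let ?T = "{f. \<exists>g\<in>ideal.span ?G. pullback d f = ?z * g}"
  have "ideal.subspace ?T"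
  proof (rule ideal.subspaceI)
    have "pullback d 0 = ?z * 0" by simp
    then show "0 \<in> ?T" using ideal.span_zero by blast
    show "f + f' \<in> ?T" if sum: "f \<in> ?T" "f' \<in> ?T" for f f'
    proof -
      obtain g g' where g: "g \<in> ideal.span ?G" "pullback d f = ?z * g"
        and g': "g' \<in> ideal.span ?G" "pullback d f' = ?z * g'"
        using sum by blast
      have "pullback d (f + f') = ?z * (g + g')"
        by (simp only: pullback_add g(2) g'(2) distrib_left)
      then show ?thesis using ideal.span_add[OF g(1) g'(1)] by blast
    qed
    show "c * f \<in> ?T" if prod: "f \<in> ?T" for c f
    proof -
      obtain g where g: "g \<in> ideal.span ?G" "pullback d f = ?z * g"
        using prod by blast
      have "pullback d (c * f) = ?z * (pullback d c * g)"
        by (simp only: pullback_mult g(2) mult_ac)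
      then show ?thesis using ideal.span_scale[OF g(1)] by blast
    qed
  qed
  moreover have "S \<subseteq> ?T"
  proof
    fix f assume "f \<in> S"
    have "?z dvd pullback d f"
      by (rule exc_power_dvd_pullback) (rule cps_coeff_below_ideal_mult[OF \<open>f \<in> S\<close>])
    then obtain g where "pullback d f = ?z * g" by (rule dvdE)
    moreover from this have "g \<in> ideal.span ?G"
      using \<open>f \<in> S\<close> by (intro ideal.span_base) blast
    ultimately show "f \<in> ?T" by blast
  qed
  ultimately have "ideal.span S \<subseteq> ?T" by (intro ideal.span_minimal)
  then have "{g. \<exists>f\<in>ideal.span S. pullback d f = ?z * g} \<subseteq> ideal.span ?G"
    by auto
  then have "ideal.span {g. \<exists>f\<in>ideal.span S. pullback d f = ?z * g} \<subseteq> ideal.span ?G"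
    by (rule ideal.span_minimal) (rule ideal.subspace_span)
  moreover have "ideal.span ?G \<subseteq> ideal.span {g. \<exists>f\<in>ideal.span S. pullback d f = ?z * g}"
    by (rule ideal.span_mono) (auto intro: ideal.span_base)
  ultimately show ?thesis
    unfolding ideal_transform1_def ideal_mult_span[OF assms] by blast
qed

text \<open>
  The total transform of the ideal is \<open>M p\<close> times its iterated transform, expressed through generators.
  The divisibility is carried along in the induction because it guarantees that no generator is lost among
  the quotients by \<open>M p\<close>.
\<close>

lemma ideal_transform_span:
  assumes "\<not> S \<subseteq> {0}"
  defines "M \<equiv> exc_factor (\<lambda>q. ideal_mult_at q (ideal.span S))"
  shows "ideal_transform p (ideal.span S) = ideal.span {g. \<exists>f\<in>S. total_transform p f = M p * g}
    \<and> (\<forall>f\<in>S. M p dvd total_transform p f)"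
proof (induction p rule: rev_induct)
  case Nil
  show ?case by (simp add: ideal_transform_def M_def)
next
  case (snoc d p)
  let ?S = "{g. \<exists>f\<in>S. total_transform p f = M p * g}"
  let ?e = "ideal_mult ?S"
  have M: "M q \<noteq> 0" for q by (simp add: M_def)
  have nz: "\<not> ?S \<subseteq> {0}"
  proof -
    obtain f where f: "f \<in> S" "f \<noteq> 0" using assms by blast
    then obtain g where "total_transform p f = M p * g" using snoc by (meson dvdE)
    moreover from this f have "g \<noteq> 0" by auto
    ultimately show ?thesis using f by blast
  qed
  have e: "ideal_mult_at p (ideal.span S) = ?e"
    unfolding ideal_mult_at_def using snoc ideal_mult_span[OF nz] by simp
  have M_snoc: "M (p @ [d]) = pullback d (M p) * exc d ^ ?e"
    unfolding e[symmetric] by (simp add: M_def exc_factor_snoc)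
  have lift: "\<exists>h\<in>?S. total_transform p f = M p * h \<and> exc d ^ ?e dvd pullback d h" if "f \<in> S" for f
  proof -
    obtain h where h: "total_transform p f = M p * h" using snoc \<open>f \<in> S\<close> by (meson dvdE)
    then have "h \<in> ?S" using \<open>f \<in> S\<close> by blast
    moreover from this have "exc d ^ ?e dvd pullback d h"
      by (intro exc_power_dvd_pullback cps_coeff_below_ideal_mult)
    ultimately show ?thesis using h by blast
  qed
  \<comment> \<open>The common factor \<open>pullback d (M p)\<close> cancels.\<close>
  have step: "total_transform (p @ [d]) f = M (p @ [d]) * g \<longleftrightarrow> pullback d h = exc d ^ ?e * g"
    if "total_transform p f = M p * h" for f g h
    unfolding total_transform_snoc that pullback_mult M_snoc mult.assoc
    using M by simp
  have "{g. \<exists>h\<in>?S. pullback d h = exc d ^ ?e * g} =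
      {g. \<exists>f\<in>S. total_transform (p @ [d]) f = M (p @ [d]) * g}"
    using step lift by blast
  then have "ideal_transform (p @ [d]) (ideal.span S) =
      ideal.span {g. \<exists>f\<in>S. total_transform (p @ [d]) f = M (p @ [d]) * g}"
    using snoc ideal_transform1_span[OF nz, of d] by (simp add: ideal_transform_def)
  moreover have "M (p @ [d]) dvd total_transform (p @ [d]) f" if f: "f \<in> S" for f
  proof -
    obtain h where h: "total_transform p f = M p * h" "exc d ^ ?e dvd pullback d h"
      using lift[OF f] by blast
    from h(2) obtain g where "pullback d h = exc d ^ ?e * g" by (rule dvdE)
    then show ?thesis using step[OF h(1)] by (intro dvdI) blast
  qed
  ultimately show ?case by blast
qed

text \<open>
  By the factorization above, the total transforms of the generators have least multiplicity
  \<open>cps_multiplicity (exc_factor e p) + e p\<close>, where \<open>e\<close> gives the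
  multiplicities of the ideal; this is the virtual value at \<open>p\<close>.
\<close>

lemma base_value_span:
  assumes "\<not> S \<subseteq> {0}"
  shows "base_value (ideal.span S) p = ideal_mult (total_transform p ` S)"
proof -
  let ?M = "exc_factor (\<lambda>q. ideal_mult_at q (ideal.span S)) p"
  let ?S = "{g. \<exists>f\<in>S. total_transform p f = ?M * g}"
  have dvd: "\<exists>g. total_transform p f = ?M * g" if "f \<in> S" for f
    using ideal_transform_span[OF assms, of p] that by (meson dvdE)
  have img: "total_transform p ` S = (*) ?M ` ?S"
  proof
    show "total_transform p ` S \<subseteq> (*) ?M ` ?S"
      using dvd by blast
    show "(*) ?M ` ?S \<subseteq> total_transform p ` S"
    proof
      fix h assume "h \<in> (*) ?M ` ?S"
      then obtain f g where "f \<in> S" "total_transform p f = ?M * g" "h = ?M * g" by blast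
      then show "h \<in> total_transform p ` S" by (intro image_eqI[of _ _ f]) simp_all
    qed
  qed
  have nz: "\<not> ?S \<subseteq> {0}"
  proof
    assume "?S \<subseteq> {0}"
    then have "total_transform p ` S \<subseteq> {0}" unfolding img by auto
    then show False using assms by auto
  qed
  have "ideal_mult_at p (ideal.span S) = ideal_mult ?S"
    unfolding ideal_mult_at_def[of p] using ideal_transform_span[OF assms, of p] ideal_mult_span[OF nz]
    by simp
  then show ?thesis
    unfolding base_value_def values_of_eq_exc_factor img
    using ideal_mult_times_image[OF nz, of ?M] by simp
qed

section \<open>Finiteness of the set of base points\<close>

lemma ideal_transform1_memI:
  "f \<in> I \<Longrightarrow> pullback d f = exc d ^ ideal_mult I * g \<Longrightarrow> g \<in> ideal_transform1 d I"
  unfolding ideal_transform1_def by (rule ideal.span_base) blast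

lemma ideal_transform1_quotient:
  assumes "f \<in> I"
  obtains g where "pullback d f = exc d ^ ideal_mult I * g" "g \<in> ideal_transform1 d I"
proof -
  have "exc d ^ ideal_mult I dvd pullback d f"
    by (rule exc_power_dvd_pullback) (rule cps_coeff_below_ideal_mult[OF assms])
  then obtain g where "pullback d f = exc d ^ ideal_mult I * g" by (rule dvdE)
  then show ?thesis using that ideal_transform1_memI[OF assms] by blast
qed

lemma ideal_mult_at_Cons: "ideal_mult_at (d # p) I = ideal_mult_at p (ideal_transform1 d I)"
  by (simp add: ideal_mult_at_def ideal_transform_def)

lemma ideal_mult_eq_0:
  assumes "f \<in> I" "cps_coeff f 0 0 \<noteq> 0"
  shows "ideal_mult I = 0"
proof -
  have "f \<noteq> 0" using assms(2) by auto
  then show ?thesis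
    using ideal_mult_le[OF assms(1)] cps_multiplicity_eq_0_iff[of f] assms(2) by simp
qed

text \<open>
  A nonvanishing element pulls back to nonvanishing elements, so it keeps all multiplicities at 0.
\<close>

lemma base_points_eq_empty:
  assumes "f \<in> I" "cps_coeff f 0 0 \<noteq> 0"
  shows "base_points I = {}"
proof -
  have "ideal_mult_at p I = 0" for p
    using assms
  proof (induction p arbitrary: f I)
    case Nil
    then show ?case by (simp add: ideal_mult_at_def ideal_transform_def ideal_mult_eq_0)
  next
    case (Cons d p)
    have "pullback d f \<in> ideal_transform1 d I"
      using Cons.prems by (intro ideal_transform1_memI[of f]) (simp_all add: ideal_mult_eq_0)
    moreover have "cps_coeff (pullback d f) 0 0 \<noteq> 0"
      using Cons.prems by (simp add: cps_coeff_0_0_pullback)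
    ultimately show ?case
      unfolding ideal_mult_at_Cons by (rule Cons.IH)
  qed
  then show ?thesis by (simp add: base_points_def)
qed

text \<open>
  At slope \<open>t\<close> the transform of \<open>f\<close> has as constant term the value at \<open>(1, t)\<close> of the initial form of \<open>f\<close>, which
  vanishes for finitely many \<open>t\<close> only.
\<close>

lemma finite_directions_through_tangent_cone:
  assumes "f \<in> I" "f \<noteq> 0" "cps_multiplicity f = ideal_mult I"
  shows "finite {d. base_points (ideal_transform1 d I) \<noteq> {}}"
proof (rule finite_subset)
  let ?e = "ideal_mult I"
  let ?Z = "{t. (\<Sum>k\<le>?e. cps_coeff f (?e - k) k * t ^ k) = 0}"
  show "{d. base_points (ideal_transform1 d I) \<noteq> {}} \<subseteq> insert Vertical (Slope ` ?Z)"
  proof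
    fix d assume d: "d \<in> {d. base_points (ideal_transform1 d I) \<noteq> {}}"
    show "d \<in> insert Vertical (Slope ` ?Z)"
    proof (cases d)
      case (Slope t)
      obtain g where g: "pullback d f = exc d ^ ?e * g" "g \<in> ideal_transform1 d I"
        using ideal_transform1_quotient[OF assms(1)] .
      have "cps_coeff g 0 0 = cps_coeff (pullback d f) ?e 0"
        unfolding g(1) by (simp add: Slope cps_coeff_X_power_mult)
      also have "\<dots> = (\<Sum>k\<le>?e. cps_coeff f (?e - k) k * t ^ k)"
        by (simp add: Slope cps_coeff_pullback_slope fps_power_zeroth)
      finally have "(\<Sum>k\<le>?e. cps_coeff f (?e - k) k * t ^ k) = 0"
        using d base_points_eq_empty[OF g(2)] by auto
      then show ?thesis using Slope by blast
    qed simp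
  qed
  obtain i j where "i + j = ?e" "cps_coeff f i j \<noteq> 0"
    using cps_multiplicity_attained[OF assms(2)] assms(3) by metis
  then have "j \<le> ?e \<and> cps_coeff f (?e - j) j \<noteq> 0" by (metis add_diff_cancel_right' le_add2)
  then have "finite ?Z"
    using polyfun_finite_roots[of "\<lambda>k. cps_coeff f (?e - k) k" ?e] by blast
  then show "finite (insert Vertical (Slope ` ?Z))" by simp
qed

lemma base_points_subset:
  "base_points I \<subseteq> insert [] (\<Union>d\<in>{d. base_points (ideal_transform1 d I) \<noteq> {}}.
     Cons d ` base_points (ideal_transform1 d I))"
proof
  fix p assume p: "p \<in> base_points I"
  show "p \<in> insert [] (\<Union>d\<in>{d. base_points (ideal_transform1 d I) \<noteq> {}}.
     Cons d ` base_points (ideal_transform1 d I))"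
  proof (cases p)
    case (Cons d q)
    then have "q \<in> base_points (ideal_transform1 d I)"
      using p by (simp add: base_points_def ideal_mult_at_Cons)
    then show ?thesis using Cons by blast
  qed simp
qed

text \<open>
  Each pair excludes at most one scalar.
\<close>

lemma ex_generic_scalar:
  fixes F :: "(complex \<times> complex) set"
  assumes "finite F" "(0, 0) \<notin> F"
  obtains c where "\<And>\<alpha> \<beta>. (\<alpha>, \<beta>) \<in> F \<Longrightarrow> \<alpha> + c * \<beta> \<noteq> 0"
proof -
  have "finite ((\<lambda>(\<alpha>, \<beta>). - \<alpha> / \<beta>) ` F)" using assms by simp
  then obtain c where c: "c \<notin> (\<lambda>(\<alpha>, \<beta>). - \<alpha> / \<beta>) ` F"
    using ex_new_if_finite[OF infinite_UNIV_char_0] by blast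
  have "\<alpha> + c * \<beta> \<noteq> 0" if F: "(\<alpha>, \<beta>) \<in> F" for \<alpha> \<beta>
  proof (cases "\<beta> = 0")
    case True
    then show ?thesis using F assms(2) by auto
  next
    case False
    have "c \<noteq> - \<alpha> / \<beta>" using c F by force
    then show ?thesis using False by (simp add: field_simps eq_neg_iff_add_eq_0 add.commute)
  qed
  then show ?thesis using that by blast
qed

text \<open>
  The behaviour of the intersection number \<open>a A + b B\<close> of \<open>x^a y^b\<close> with a curve of multiplicity \<open>e\<close> that
  meets the axes with multiplicities \<open>A\<close> and \<open>B\<close>. After a blow-up in the direction of slope 0, and division by
  the \<open>e\<close>-th power of the exceptional equation, the exponents are \<open>a + b - e\<close> and \<open>b\<close>, while the transformed
  curve meets the exceptional axis with multiplicity \<open>k \<le> e\<close> and the other axis with multiplicity \<open>B - e\<close>.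
  The number drops by at least \<open>e\<^sup>2\<close>. The assumptions on \<open>A\<close> and \<open>B\<close> are conditional since the curve may
  contain an axis that does not occur in \<open>x^a y^b\<close>.
\<close>

lemma intersection_number_decreases:
  fixes a b e k A B :: nat
  assumes "e > 0" "e \<le> a + b" "k \<le> e" "a > 0 \<Longrightarrow> e \<le> A" "b > 0 \<Longrightarrow> e \<le> B"
  shows "(a + b - e) * k + b * (B - e) < a * A + b * B"
proof -
  have "b * (B - e) + b * e = b * B"
    using assms(5) by (cases "b = 0") (auto simp flip: distrib_left)
  moreover have "a * e \<le> a * A" using assms(4) by (cases "a = 0") auto
  moreover have "(a + b - e) * k \<le> (a + b - e) * e" using assms(3) by simp
  moreover have "(a + b - e) * e + e * e = a * e + b * e"
    using assms(2) by (simp flip: distrib_right)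
  moreover have "e * e > 0" using assms(1) by simp
  ultimately show ?thesis by linarith
qed

lemma cps_coeff_0_0_power [simp]: "cps_coeff (f ^ n) 0 0 = cps_coeff f 0 0 ^ n"
proof (induction n)
  case 0
  show ?case by transfer simp
qed simp

lemma cps_coeff_0_0_const [simp]: "cps_coeff (cps_const c) 0 0 = c"
  by transfer simp

lemma pullback_monomial_slope:
  "pullback (Slope t) (cps_X ^ a * cps_Y ^ b * u) =
     cps_X ^ (a + b) * ((cps_Y + cps_const t) ^ b * pullback (Slope t) u)"
  by (simp only: pullback_mult pullback_power pullback_X pullback_Y direction.case
      power_mult_distrib power_add mult_ac)

lemma pullback_monomial_vertical:
  "pullback Vertical (cps_X ^ a * cps_Y ^ b * u) =
     cps_X ^ a * cps_Y ^ (b + a) * pullback Vertical u"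
  by (simp only: pullback_mult pullback_power pullback_X pullback_Y direction.case
      power_mult_distrib power_add mult_ac)

text \<open>
  Induction on \<open>a A + b B\<close>, an upper bound for the intersection number at \<open>O\<close> of the two elements
  \<open>x^a y^b u\<close> and \<open>g\<close> of the ideal. The unit \<open>u\<close> is there because away from slope 0 and from the vertical
  direction the second axis no longer passes through the new point and its equation becomes a unit.
\<close>

lemma finite_base_points_monomial:
  assumes "ideal.subspace I"
    and "cps_X ^ a * cps_Y ^ b * u \<in> I" "cps_coeff u 0 0 \<noteq> 0"
    and "g \<in> I" "a > 0 \<Longrightarrow> cps_coeff g 0 A \<noteq> 0" "b > 0 \<Longrightarrow> cps_coeff g B 0 \<noteq> 0"
  shows "finite (base_points I)"
  using assms
proof (induction "a * A + b * B" arbitrary: I a b u g A B rule: less_induct)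
  case less
  let ?e = "ideal_mult I"
  let ?mono = "cps_X ^ a * cps_Y ^ b * u"
  show ?case
  proof (cases "\<exists>f\<in>I. cps_coeff f 0 0 \<noteq> 0")
    case True
    then show ?thesis using base_points_eq_empty by force
  next
    case False
    have u: "u \<noteq> 0" using less.prems(3) by auto
    have XY: "cps_X \<noteq> 0" "cps_Y \<noteq> 0" "cps_multiplicity cps_X = 1" "cps_multiplicity cps_Y = 1"
      using exc_neq_0[of "Slope 0"] exc_neq_0[of Vertical]
        cps_multiplicity_exc[of "Slope 0"] cps_multiplicity_exc[of Vertical] by simp_all
    have mono: "?mono \<noteq> 0" "cps_multiplicity ?mono = a + b"
      using u XY less.prems(3)
      by (simp_all add: cps_multiplicity_mult cps_multiplicity_power cps_multiplicity_eq_0_iff)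
    have e_le: "?e \<le> a + b"
      using ideal_mult_le[OF less.prems(2) mono(1)] mono(2) by simp
    obtain h where h: "h \<in> I" "h \<noteq> 0" "cps_multiplicity h = ?e"
      using ideal_mult_attained[of I] less.prems(2) mono(1) by blast
    have e_pos: "?e > 0"
      using False h cps_multiplicity_eq_0_iff[of h] by auto
    obtain i j where ij: "i + j = ?e" "cps_coeff h i j \<noteq> 0"
      using cps_multiplicity_attained[OF h(2)] h(3) by metis
    \<comment> \<open>The multiple of \<open>h\<close> to be added to \<open>g\<close> must cancel neither a term of degree \<open>?e\<close> nor the
      terms \<open>y^A\<close> and \<open>x^B\<close>.\<close>
    define F where "F = {(cps_coeff g i j, cps_coeff h i j)} \<union>
      (if a > 0 then {(cps_coeff g 0 A, cps_coeff h 0 A)} else {}) \<union>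
      (if b > 0 then {(cps_coeff g B 0, cps_coeff h B 0)} else {})"
    have "finite F" "(0, 0) \<notin> F"
      using ij(2) less.prems(5,6) by (auto simp: F_def)
    then obtain c where c: "\<And>\<alpha> \<beta>. (\<alpha>, \<beta>) \<in> F \<Longrightarrow> \<alpha> + c * \<beta> \<noteq> 0"
      using ex_generic_scalar by blast
    define g' where "g' = g + cps_const c * h"
    have g'I: "g' \<in> I"
      unfolding g'_def using less.prems(1,4) h(1)
      by (simp add: ideal.subspace_add ideal.subspace_scale)
    have g'_ij: "cps_coeff g' i j \<noteq> 0"
      using c[of "cps_coeff g i j" "cps_coeff h i j"] by (simp add: g'_def F_def)
    have g'_A: "cps_coeff g' 0 A \<noteq> 0" if "a > 0"
      using c[of "cps_coeff g 0 A" "cps_coeff h 0 A"] that by (simp add: g'_def F_def)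
    have g'_B: "cps_coeff g' B 0 \<noteq> 0" if "b > 0"
      using c[of "cps_coeff g B 0" "cps_coeff h B 0"] that by (simp add: g'_def F_def)
    have A: "?e \<le> A" if "a > 0"
      using cps_coeff_below_ideal_mult[OF g'I, of 0 A] g'_A[OF that] by (metis add_0 not_less)
    have B: "?e \<le> B" if "b > 0"
      using cps_coeff_below_ideal_mult[OF g'I, of B 0] g'_B[OF that] by (metis add_0_right not_less)
    have step: "finite (base_points (ideal_transform1 d I))" for d
    proof -
      let ?J = "ideal_transform1 d I"
      have J: "ideal.subspace ?J"
        unfolding ideal_transform1_def by (rule ideal.subspace_span)
      obtain q where q: "pullback d g' = exc d ^ ?e * q" "q \<in> ?J"
        using ideal_transform1_quotient[OF g'I] .
      obtain k where k: "k \<le> ?e" "on_exceptional d q k \<noteq> 0"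
        using on_exceptional_weak_transform[OF g'_ij, of d q] q(1) ij(1) by metis
      have pu: "cps_coeff (pullback d u) 0 0 \<noteq> 0"
        using less.prems(3) by (simp add: cps_coeff_0_0_pullback)
      \<comment> \<open>The strict transforms of the axes pass through the points of slope 0 and of vertical direction;
        elsewhere only the exceptional divisor remains.\<close>
      consider "d = Slope 0" | t where "d = Slope t" "t \<noteq> 0" | "d = Vertical"
        by (cases d) auto
      then show ?thesis
      proof cases
        case 1
        have "pullback d ?mono = exc d ^ ?e * (cps_X ^ (a + b - ?e) * cps_Y ^ b * pullback d u)"
        proof -
          have "cps_const 0 = 0" by transfer simp
          then have "pullback d ?mono = cps_X ^ (a + b) * cps_Y ^ b * pullback d u"
            unfolding 1 pullback_monomial_slope by (simp only: add_0_right mult.assoc)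
          also have "cps_X ^ (a + b) = exc d ^ ?e * cps_X ^ (a + b - ?e)"
            using e_le by (simp only: 1 exc.simps le_add_diff_inverse power_add[symmetric])
          finally show ?thesis by (simp only: mult_ac)
        qed
        then have "cps_X ^ (a + b - ?e) * cps_Y ^ b * pullback d u \<in> ?J"
          by (rule ideal_transform1_memI[OF less.prems(2)])
        moreover have "cps_coeff q (B - ?e) 0 \<noteq> 0" if "b > 0"
        proof -
          have "cps_coeff q (B - ?e) 0 = cps_coeff (pullback d g') B 0"
            unfolding q(1) unfolding 1 exc.simps cps_coeff_X_power_mult using B[OF that] by simp
          also have "\<dots> = (\<Sum>k\<le>B. if k = 0 then cps_coeff g' B 0 else 0)"
            unfolding 1 pullback.simps cps_coeff_pullback_slope
            by (intro sum.cong) (auto simp: fps_power_zeroth)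
          finally show ?thesis using g'_B[OF that] by simp
        qed
        moreover have "cps_coeff q 0 k \<noteq> 0" using k(2) 1 by simp
        moreover have "(a + b - ?e) * k + b * (B - ?e) < a * A + b * B"
          by (rule intersection_number_decreases[OF e_pos e_le k(1) A B])
        ultimately show ?thesis
          using less.hyps[OF _ J _ pu q(2)] by blast
      next
        case (2 t)
        let ?u = "(cps_Y + cps_const t) ^ b * pullback d u"
        have "pullback d ?mono = exc d ^ ?e * (cps_X ^ (a + b - ?e) * cps_Y ^ 0 * ?u)"
        proof -
          have "pullback d ?mono = cps_X ^ (a + b) * ?u"
            unfolding 2 by (rule pullback_monomial_slope)
          also have "cps_X ^ (a + b) = exc d ^ ?e * cps_X ^ (a + b - ?e)"
            using e_le by (simp only: 2 exc.simps le_add_diff_inverse power_add[symmetric])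
          finally show ?thesis by (simp only: power_0 mult_1_right mult.assoc)
        qed
        then have "cps_X ^ (a + b - ?e) * cps_Y ^ 0 * ?u \<in> ?J"
          by (rule ideal_transform1_memI[OF less.prems(2)])
        moreover have "cps_coeff ?u 0 0 \<noteq> 0"
          using pu 2 by (simp add: cps_coeff_Y)
        moreover have "cps_coeff q 0 k \<noteq> 0" using k(2) 2 by simp
        moreover have "(a + b - ?e) * k + 0 * 0 < a * A + b * B"
          using intersection_number_decreases[OF e_pos e_le k(1) A B] by simp
        ultimately show ?thesis
          using less.hyps[of "a + b - ?e" k 0 0, OF _ J _ _ q(2)] by blast
      next
        case 3
        \<comment> \<open>The axes exchange their roles here: the exceptional divisor is now \<open>y = 0\<close>.\<close>
        have "pullback d ?mono = exc d ^ ?e * (cps_X ^ a * cps_Y ^ (b + a - ?e) * pullback d u)"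
        proof -
          have "pullback d ?mono = cps_X ^ a * cps_Y ^ (b + a) * pullback d u"
            unfolding 3 by (rule pullback_monomial_vertical)
          also have "cps_Y ^ (b + a) = exc d ^ ?e * cps_Y ^ (b + a - ?e)"
            using e_le by (simp only: 3 exc.simps add.commute[of b a] le_add_diff_inverse
                power_add[symmetric])
          finally show ?thesis by (simp only: mult_ac)
        qed
        then have "cps_X ^ a * cps_Y ^ (b + a - ?e) * pullback d u \<in> ?J"
          by (rule ideal_transform1_memI[OF less.prems(2)])
        moreover have "cps_coeff q 0 (A - ?e) \<noteq> 0" if "a > 0"
        proof -
          have "cps_coeff q 0 (A - ?e) = cps_coeff (pullback d g') 0 A"
            unfolding q(1) unfolding 3 exc.simps cps_coeff_Y_power_mult using A[OF that] by simp
          also have "\<dots> = cps_coeff g' 0 A"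
            by (simp add: 3 cps_coeff_pullback_vertical)
          finally show ?thesis using g'_A[OF that] by simp
        qed
        moreover have "cps_coeff q k 0 \<noteq> 0" using k(2) 3 by simp
        moreover have "a * (A - ?e) + (b + a - ?e) * k < a * A + b * B"
          using intersection_number_decreases[of ?e b a k B A] e_pos e_le k(1) A B
          by (simp only: add.commute)
        ultimately show ?thesis
          using less.hyps[OF _ J _ pu q(2)] by blast
      qed
    qed
    show ?thesis
      using finite_subset[OF base_points_subset] step
        finite_directions_through_tangent_cone[OF h] by blast
  qed
qed

text \<open>
  The radical contains both coordinates, so the ideal contains \<open>x^n\<close> and \<open>y^m\<close>, whose intersection number
  \<open>n m\<close> starts the induction.
\<close>

lemma finite_base_points:
  assumes "m_primary I"
  shows "finite (base_points I)"
proof -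
  have I: "ideal.subspace I" and rad: "ideal_radical I = max_ideal"
    using assms by (auto simp: m_primary_def primary_ideal_def)
  have "cps_X \<in> max_ideal" "cps_Y \<in> max_ideal"
    by (simp_all add: max_ideal_def cps_coeff_X cps_coeff_Y)
  then obtain n m where n: "cps_X ^ n \<in> I" and m: "cps_Y ^ m \<in> I"
    unfolding rad[symmetric] ideal_radical_def by blast
  have one: "cps_coeff 1 0 0 = 1" by transfer simp
  have "cps_coeff (cps_Y ^ m) 0 m = 1"
    using cps_coeff_Y_power_mult[of m 1 0 m] one by simp
  then show ?thesis
    by (intro finite_base_points_monomial[OF I _ _ m, of n 0 1 m 0]) (use n one in simp_all)
qed

section \<open>The two clusters agree\<close>

text \<open>
  Both sides are the least multiplicity at \<open>p\<close> of the total transforms of the generators; vanishing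
  generators have value \<open>\<infinity>\<close> on the left and are left out of the minimum on the right.
\<close>

lemma min_value_eq_base_value:
  fixes f :: "nat \<Rightarrow> cps"
  assumes "\<not> f ` {1..r} \<subseteq> {0}"
  shows "min_value r f p = enat (base_value (ideal.span (f ` {1..r})) p)"
proof -
  let ?S = "f ` {1..r}"
  let ?T = "total_transform p ` ?S"
  have "\<not> ?T \<subseteq> {0}" using assms by (auto simp: image_subset_iff)
  then obtain h where h: "h \<in> ?T" "h \<noteq> 0" "cps_multiplicity h = ideal_mult ?T"
    by (rule ideal_mult_attained)
  from h(1) obtain i where "i \<in> {1..r}" "h = total_transform p (f i)"
    by blast
  with h have i: "i \<in> {1..r}" "f i \<noteq> 0"
      "cps_multiplicity (total_transform p (f i)) = ideal_mult ?T"
    by simp_all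
  have "min_value r f p = enat (ideal_mult ?T)"
    unfolding min_value_def
  proof (rule Min_eqI)
    show "enat (ideal_mult ?T) \<in> (\<lambda>i. value_at p (f i)) ` {1..r}"
      using i by (intro image_eqI[of _ _ i]) (simp_all add: value_at_eq_total_transform)
    show "enat (ideal_mult ?T) \<le> v" if v: "v \<in> (\<lambda>i. value_at p (f i)) ` {1..r}" for v
    proof -
      obtain j where j: "j \<in> {1..r}" "v = value_at p (f j)" using v by blast
      show ?thesis
      proof (cases "f j = 0")
        case True
        then show ?thesis by (simp add: j(2) value_at_def)
      next
        case False
        then show ?thesis
          using j(1) unfolding j(2) value_at_eq_total_transform[OF False] enat_ord_simps
          by (intro ideal_mult_le) simp_all
      qed
    qed
  qed simp
  then show ?thesis using base_value_span[OF assms] by simp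
qed

lemma generators_nonzero_if_m_primary:
  assumes "m_primary (ideal.span S)"
  shows "\<not> S \<subseteq> {0}"
proof
  assume "S \<subseteq> {0}"
  then have "ideal.span S \<subseteq> {0}"
    using ideal.span_minimal[OF _ ideal.subspace_single_0] by blast
  moreover have "cps_X \<in> ideal_radical (ideal.span S)"
    using assms by (simp add: m_primary_def max_ideal_def cps_coeff_X)
  then obtain n where "cps_X ^ n \<in> ideal.span S" by (auto simp: ideal_radical_def)
  ultimately have "cps_X ^ n = 0" by blast
  then show False using exc_neq_0[of "Slope 0"] by simp
qed

theorem theorem3p8:
  fixes f :: "nat \<Rightarrow> cps" and r :: nat and \<aa> :: "cps set"
  assumes "\<aa> = ideal.span (f ` {1..r})" and "m_primary \<aa>"
  shows "base_points \<aa> = value_cluster r f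
    \<and> (\<forall>p\<in>value_cluster r f. enat (base_value \<aa> p) = min_value r f p)
    \<and> finite (value_cluster r f)"
proof -
  have nz: "\<not> f ` {1..r} \<subseteq> {0}"
    using assms generators_nonzero_if_m_primary by blast
  have min: "min_value r f p = enat (base_value \<aa> p)" for p
    unfolding assms(1) by (rule min_value_eq_base_value[OF nz])
  \<comment> \<open>At \<open>O\<close>, which is proximate to no point, the sum is empty and agrees with \<open>h\<^sub>O = 0\<close>.\<close>
  have prox: "prox_value r f p = (\<Sum>q\<in>{q. proximate p q}. enat (base_value \<aa> q))" for p
    by (auto simp: prox_value_def min proximate_def)
  have "prox_value r f p < min_value r f p \<longleftrightarrow> ideal_mult_at p \<aa> > 0" for p
    unfolding prox min sum_enat enat_ord_simps
    by (simp add: base_value_def values_of.simps[of _ p])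
  then have "base_points \<aa> = value_cluster r f"
    by (simp add: base_points_def value_cluster_def)
  then show ?thesis
    using min finite_base_points[OF assms(2)] by simp
qed

end
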